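(* Given a string $T$ of length $n$ (over an ordered alphabet, terminated by the unique smallest symbol $\$$), one can compute its Burrows–Wheeler transform in place (overwriting $T$) together with its $\mathsf{LCP}$ array stored in compressed form as the concatenation, in order $i=0,1,\dots,n-1$, of the Elias $\delta$-codes of $\mathsf{LCP}[i]+1$, in $O(n^2)$ time using $O(1)$ additional space; this compressed $\mathsf{LCP}$ representation occupies $O(n\log\log n)$ bits in the average case.
   Context: Let $\Sigma$ be a totally ordered alphabet and $\$\notin\Sigma$ a symbol smaller than all symbols of $\Sigma$; $T=T[0]\cdots T[n-1]$ with $T[0,n-2]\in\Sigma^+$ and $T[n-1]=\$$, and $T_k=T[k,n-1]$. The suffix array $\mathsf{SA}$ is the permutation of $\{0,\dots,n-1\}$ with $T_{\mathsf{SA}[0]}<\cdots<T_{\mathsf{SA}[n-1]}$ lexicographically; $\mathsf{BWT}[i]=T[\mathsf{SA}[i]-1]$ if $\mathsf{SA}[i]\ne0$ and $\$$ otherwise; $\mathsf{LCP}[0]=0$ and $\mathsf{LCP}[i]$ is the length of the longest common prefix of $T_{\mathsf{SA}[i]}$ and $T_{\mathsf{SA}[i-1]}$ for $i\ge1$. The Elias $\gamma$-code of an integer $\ell\ge1$ is $\lfloor\log_2\ell\rfloor$ zero bits, then a one bit, then the binary representation of $\ell$ without its most significant bit; the Elias $\delta$-code of $\ell$ is the $\gamma$-code of $1+\lfloor\log_2\ell\rfloor$ followed by the binary representation of $\ell$ without its most significant bit, using $2\lfloor\log_2(\lfloor\log_2\ell\rfloor+1)\rfloor+1+\lfloor\log_2\ell\rfloor$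 bits. Model: word RAM with $\Omega(\log n)$-bit words, in which a $\delta$-code can be encoded/decoded in constant time; additional space is measured in words beyond the array holding $T$/$\mathsf{BWT}$ and the bit array holding the compressed $\mathsf{LCP}$. "Average case" refers to inputs for which the $\mathsf{LCP}$ entries are $O(\log n)$ in expectation, as for random texts. *)

theory Defs
  imports
    "HOL-Library.Discrete_Functions"
    "HOL-Library.Landau_Symbols"
    "HOL-Library.List_Lexorder"
    "HOL-Library.Sublist"
    "HOL-Probability.Probability_Mass_Function"
begin

section \<open>Texts, suffix array, Burrows--Wheeler transform, LCP array\<close>

text \<open>
  The sentinel \<open>d\<close> plays the role of the dollar sign. The order on lists is the
  lexicographic one of \<open>List_Lexorder\<close>, where a proper prefix is smaller.
\<close>

definition texts :: "'a::linorder \<Rightarrow> 'a set \<Rightarrow> nat \<Rightarrow> 'a list set" where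
  "texts d \<Sigma> n = {u @ [d] | u. u \<noteq> [] \<and> set u \<subseteq> \<Sigma> \<and> length u + 1 = n}"

definition suffix_array :: "'a::linorder list \<Rightarrow> nat list" where
  "suffix_array T = sort_key (\<lambda>k. drop k T) [0..<length T]"

lemma suffix_array_permutation:
  "mset (suffix_array T) = mset [0..<length T]"
  by (simp add: suffix_array_def)

lemma suffix_array_strictly_sorted:
  "sorted_wrt (\<lambda>i j. drop i T < drop j T) (suffix_array T)"
proof -
  let ?xs = "map (\<lambda>k. drop k T) (suffix_array T)"
  have s: "set (suffix_array T) = {0..<length T}" and "distinct (suffix_array T)"
    by (auto simp: suffix_array_def)
  moreover have "inj_on (\<lambda>k. drop k T) {0..<length T}"
  proof (rule inj_onI)
    fix i j assume "i \<in> {0..<length T}" "j \<in> {0..<length T}" "drop i T = drop j T"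
    then have "length T - i = length T - j" "i < length T" "j < length T"
      by (auto dest: arg_cong[of _ _ length])
    then show "i = j" by linarith
  qed
  ultimately have "distinct ?xs" by (simp add: distinct_map)
  moreover have "sorted ?xs" by (simp add: suffix_array_def)
  ultimately have "sorted_wrt (<) ?xs" by (simp add: strict_sorted_iff)
  then show ?thesis by (simp add: sorted_wrt_map)
qed

definition bwt :: "'a::linorder \<Rightarrow> 'a list \<Rightarrow> 'a list" where
  "bwt d T = map (\<lambda>k. if k \<noteq> 0 then T ! (k - 1) else d) (suffix_array T)"

definition lcp_array :: "'a::linorder list \<Rightarrow> nat list" where
  "lcp_array T = map (\<lambda>i. if i = 0 then 0 else
       length (longest_common_prefix (drop (suffix_array T ! i) T)
                                     (drop (suffix_array T ! (i - 1)) T)))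
     [0..<length T]"


section \<open>Elias codes\<close>

text \<open>
  \<open>low_bits l\<close> is the binary representation of \<open>l\<close>, most significant bit first, without
  its leading one. The codes are meaningful for \<open>l \<ge> 1\<close> only.
\<close>

definition low_bits :: "nat \<Rightarrow> bool list" where
  "low_bits l = map (bit l) (rev [0..<floor_log l])"

definition elias_gamma :: "nat \<Rightarrow> bool list" where
  "elias_gamma l = replicate (floor_log l) False @ [True] @ low_bits l"

definition elias_delta :: "nat \<Rightarrow> bool list" where
  "elias_delta l = elias_gamma (1 + floor_log l) @ low_bits l"

definition compressed_lcp :: "'a::linorder list \<Rightarrow> bool list" where
  "compressed_lcp T = concat (map (\<lambda>l. elias_delta (l + 1)) (lcp_array T))"

lemma length_elias_delta:
  "length (elias_delta l) = 2 * floor_log (floor_log l + 1) + 1 + floor_log l"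
  by (simp add: elias_delta_def elias_gamma_def low_bits_def)

lemma low_bits_inject:
  assumes "l \<ge> 1" "m \<ge> 1" "floor_log l = floor_log m" "low_bits l = low_bits m"
  shows "l = m"
proof -
  define k where "k = floor_log l"
  have *: "\<And>x::nat. x \<ge> 1 \<Longrightarrow> floor_log x = k \<Longrightarrow> x = 2 ^ k + take_bit k x"
  proof -
    fix x :: nat assume "x \<ge> 1" "floor_log x = k"
    then have "2 ^ k \<le> x" "x < 2 * 2 ^ k"
      using floor_log_exp2_le[of x] floor_log_exp2_gt[of x] by auto
    then have "x div 2 ^ k = 1" by (simp add: div_nat_eqI)
    then show "x = 2 ^ k + take_bit k x"
      by (metis add.commute div_mult_mod_eq mult.left_neutral take_bit_eq_mod add.commute)
  qed
  have "map (bit l) [0..<k] = map (bit m) [0..<k]"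
    using assms(3,4) by (simp add: low_bits_def k_def rev_map[symmetric])
  then have "take_bit k l = take_bit k m"
    by (intro bit_eqI) (auto simp: bit_take_bit_iff)
  then show ?thesis using * [of l] * [of m] assms k_def by metis
qed

lemma elias_gamma_prefix_free:
  assumes "l \<ge> 1" "m \<ge> 1" "elias_gamma l @ xs = elias_gamma m @ ys"
  shows "l = m \<and> xs = ys"
proof -
  have tw: "takeWhile Not (elias_gamma x @ zs) = replicate (floor_log x) False" for x zs
    by (simp add: elias_gamma_def takeWhile_append)
  have k: "floor_log l = floor_log m"
    using tw[of l xs] tw[of m ys] assms(3) by (metis length_replicate)
  then have "low_bits l @ xs = low_bits m @ ys"
    using assms(3) by (simp add: elias_gamma_def)
  moreover have "length (low_bits l) = length (low_bits m)"
    by (simp add: low_bits_def k)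
  ultimately show ?thesis using low_bits_inject[OF assms(1,2) k] by simp
qed

lemma elias_delta_prefix_free:
  assumes "l \<ge> 1" "m \<ge> 1" "prefix (elias_delta l) xs" "prefix (elias_delta m) xs"
  shows "l = m"
proof -
  obtain u v where "elias_delta l @ u = elias_delta m @ v"
    using assms(3,4) by (auto simp: prefix_def)
  then have e: "elias_gamma (1 + floor_log l) @ low_bits l @ u
           = elias_gamma (1 + floor_log m) @ low_bits m @ v"
    by (simp add: elias_delta_def)
  have k: "floor_log l = floor_log m" and "low_bits l @ u = low_bits m @ v"
    using elias_gamma_prefix_free[OF _ _ e] by auto
  moreover have "length (low_bits l) = length (low_bits m)"
    by (simp add: low_bits_def k)
  ultimately show ?thesis using low_bits_inject[OF assms(1,2) k] by simp
qed


section \<open>Word RAM\<close>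

text \<open>
  A machine has a fixed number of word registers, a fixed number of symbol registers, the text
  array and a bit array; none of these ever changes its length. The word size is \<open>w\<close>: a word
  register holds a natural number below \<open>2 ^ w\<close>, and arithmetic is modulo \<open>2 ^ w\<close>. The
  symbols are opaque: they can be moved and compared only, so that the text array
  and the symbol registers cannot be used to store anything but symbols. The registers are the
  only storage beyond the two arrays, and their addresses are literals of the program.
  Every access outside the registers or arrays makes the computation fail.
\<close>

record 'a state =
  wreg :: "nat list"
  sreg :: "'a list"
  tarr :: "'a list"
  barr :: "bool list"

datatype binop = Add | Sub | Mul | Div | Mod | And | Or | Xor | Shl | Shr

fun binop_val :: "nat \<Rightarrow> binop \<Rightarrow> nat \<Rightarrow> nat \<Rightarrow> nat" where
  "binop_val w Add x y = (x + y) mod 2 ^ w"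
| "binop_val w Sub x y = nat ((int x - int y) mod 2 ^ w)"
| "binop_val w Mul x y = (x * y) mod 2 ^ w"
| "binop_val w Div x y = x div y"
| "binop_val w Mod x y = x mod y"
| "binop_val w And x y = and x y"
| "binop_val w Or x y = or x y"
| "binop_val w Xor x y = xor x y"
| "binop_val w Shl x y = push_bit y x mod 2 ^ w"
| "binop_val w Shr x y = drop_bit y x"

datatype cmp = LT | LE | EQ | NE

fun cmp_val :: "cmp \<Rightarrow> 'b::linorder \<Rightarrow> 'b \<Rightarrow> bool" where
  "cmp_val LT x y = (x < y)"
| "cmp_val LE x y = (x \<le> y)"
| "cmp_val EQ x y = (x = y)"
| "cmp_val NE x y = (x \<noteq> y)"

text \<open>
  All arguments below are register numbers, except for the literal of \<open>Const\<close>.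
  \<open>LoadBits x p m\<close> and \<open>StoreBits p m x\<close> transfer a field of at most \<open>w\<close> bits (least
  significant bit first) between a word register and the bit array.
  \<open>Decode x p\<close> reads the delta code that starts at bit position \<open>p\<close>, \<open>Encode p x\<close> writes one
  there, and both advance \<open>p\<close> behind the code.
\<close>

datatype instr =
    Const nat nat
  | Move nat nat
  | Arith binop nat nat nat
  | MoveSym nat nat
  | LoadSym nat nat
  | StoreSym nat nat
  | LoadBits nat nat nat
  | StoreBits nat nat nat
  | Decode nat nat
  | Encode nat nat

definition overwrite :: "'b list \<Rightarrow> nat \<Rightarrow> 'b list \<Rightarrow> 'b list" where
  "overwrite xs p ys = take p xs @ ys @ drop (p + length ys) xs"

fun step :: "nat \<Rightarrow> instr \<Rightarrow> 'a state \<Rightarrow> 'a state option" where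
  "step w (Const x v) s =
     (if x < length (wreg s) then Some (s\<lparr>wreg := (wreg s)[x := v mod 2 ^ w]\<rparr>) else None)"
| "step w (Move x y) s =
     (if x < length (wreg s) \<and> y < length (wreg s)
      then Some (s\<lparr>wreg := (wreg s)[x := wreg s ! y]\<rparr>) else None)"
| "step w (Arith f x y z) s =
     (if x < length (wreg s) \<and> y < length (wreg s) \<and> z < length (wreg s)
      then Some (s\<lparr>wreg := (wreg s)[x := binop_val w f (wreg s ! y) (wreg s ! z)]\<rparr>) else None)"
| "step w (MoveSym a b) s =
     (if a < length (sreg s) \<and> b < length (sreg s)
      then Some (s\<lparr>sreg := (sreg s)[a := sreg s ! b]\<rparr>) else None)"
| "step w (LoadSym a x) s =
     (if a < length (sreg s) \<and> x < length (wreg s) \<and> wreg s ! x < length (tarr s)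
      then Some (s\<lparr>sreg := (sreg s)[a := tarr s ! (wreg s ! x)]\<rparr>) else None)"
| "step w (StoreSym x a) s =
     (if a < length (sreg s) \<and> x < length (wreg s) \<and> wreg s ! x < length (tarr s)
      then Some (s\<lparr>tarr := (tarr s)[wreg s ! x := sreg s ! a]\<rparr>) else None)"
| "step w (LoadBits x p m) s =
     (if x < length (wreg s) \<and> p < length (wreg s) \<and> m < length (wreg s) \<and>
         wreg s ! m \<le> w \<and> wreg s ! p + wreg s ! m \<le> length (barr s)
      then Some (s\<lparr>wreg := (wreg s)
             [x := horner_sum of_bool 2 (take (wreg s ! m) (drop (wreg s ! p) (barr s)))]\<rparr>)
      else None)"
| "step w (StoreBits p m x) s =
     (if x < length (wreg s) \<and> p < length (wreg s) \<and> m < length (wreg s) \<and>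
         wreg s ! m \<le> w \<and> wreg s ! p + wreg s ! m \<le> length (barr s)
      then Some (s\<lparr>barr := overwrite (barr s) (wreg s ! p)
                             (map (bit (wreg s ! x)) [0..<wreg s ! m])\<rparr>)
      else None)"
| "step w (Decode x p) s =
     (if x < length (wreg s) \<and> p < length (wreg s) \<and>
         (\<exists>l. 1 \<le> l \<and> l < 2 ^ w \<and> prefix (elias_delta l) (drop (wreg s ! p) (barr s)))
      then (let l = (THE l. 1 \<le> l \<and> prefix (elias_delta l) (drop (wreg s ! p) (barr s)))
            in Some (s\<lparr>wreg := (wreg s)
                  [x := l, p := (wreg s ! p + length (elias_delta l)) mod 2 ^ w]\<rparr>))
      else None)"
| "step w (Encode p x) s =
     (if x < length (wreg s) \<and> p < length (wreg s) \<and> 1 \<le> wreg s ! x \<and>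
         wreg s ! p + length (elias_delta (wreg s ! x)) \<le> length (barr s)
      then Some (s\<lparr>barr := overwrite (barr s) (wreg s ! p) (elias_delta (wreg s ! x)),
                   wreg := (wreg s)
                  [p := (wreg s ! p + length (elias_delta (wreg s ! x))) mod 2 ^ w]\<rparr>)
      else None)"

datatype test =
    WTest cmp nat nat
  | STest cmp nat nat

fun test_val :: "test \<Rightarrow> 'a::linorder state \<Rightarrow> bool option" where
  "test_val (WTest r x y) s =
     (if x < length (wreg s) \<and> y < length (wreg s)
      then Some (cmp_val r (wreg s ! x) (wreg s ! y)) else None)"
| "test_val (STest r a b) s =
     (if a < length (sreg s) \<and> b < length (sreg s)
      then Some (cmp_val r (sreg s ! a) (sreg s ! b)) else None)"

datatype prog =
    Skip
  | Instr instr
  | Seq prog prog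
  | Cond test prog prog
  | While test prog

text \<open>
  \<open>exec w P s t s'\<close>: on word size \<open>w\<close>, program \<open>P\<close> started in \<open>s\<close> terminates in \<open>s'\<close>
  after executing exactly \<open>t\<close> instructions and tests.
\<close>

inductive exec :: "nat \<Rightarrow> prog \<Rightarrow> 'a::linorder state \<Rightarrow> nat \<Rightarrow> 'a state \<Rightarrow> bool" for w where
  Skip: "exec w Skip s 0 s"
| Instr: "step w i s = Some s' \<Longrightarrow> exec w (Instr i) s 1 s'"
| Seq: "exec w P s t s' \<Longrightarrow> exec w Q s' t' s'' \<Longrightarrow> exec w (Seq P Q) s (t + t') s''"
| CondTrue: "test_val b s = Some True \<Longrightarrow> exec w P s t s' \<Longrightarrow> exec w (Cond b P Q) s (1 + t) s'"
| CondFalse: "test_val b s = Some False \<Longrightarrow> exec w Q s t s' \<Longrightarrow> exec w (Cond b P Q) s (1 + t) s'"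
| WhileTrue: "test_val b s = Some True \<Longrightarrow> exec w P s t s' \<Longrightarrow> exec w (While b P) s' t' s''
    \<Longrightarrow> exec w (While b P) s (1 + t + t') s''"
| WhileFalse: "test_val b s = Some False \<Longrightarrow> exec w (While b P) s 1 s"

inductive_cases exec_elims:
  "exec w Skip s t s'"
  "exec w (Instr i) s t s'"
  "exec w (Seq P Q) s t s'"
  "exec w (Cond b P Q) s t s'"
  "exec w (While b P) s t s'"

lemma exec_deterministic:
  "exec w P s t s' \<Longrightarrow> exec w P s u s'' \<Longrightarrow> u = t \<and> s'' = s'"
proof (induction arbitrary: u s'' rule: exec.induct)
  case (Seq P s t s' Q t' s2)
  from Seq.prems show ?case
  proof (rule exec_elims)
    fix a r b assume u: "u = a + b" and 1: "exec w P s a r" and 2: "exec w Q r b s''"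
    have "a = t \<and> r = s'" by (rule Seq.IH(1)[OF 1])
    with 2 have "b = t' \<and> s'' = s2" by (intro Seq.IH(2)) simp
    with u \<open>a = t \<and> r = s'\<close> show ?thesis by simp
  qed
next
  case (CondTrue b s P t s' Q)
  from CondTrue.prems obtain a where "u = Suc a" "exec w P s a s''"
    by (rule exec_elims) (simp_all add: CondTrue.hyps)
  with CondTrue.IH[of a s''] show ?case by simp
next
  case (CondFalse b s Q t s' P)
  from CondFalse.prems obtain a where "u = Suc a" "exec w Q s a s''"
    by (rule exec_elims) (simp_all add: CondFalse.hyps)
  with CondFalse.IH[of a s''] show ?case by simp
next
  case (WhileTrue b s P t s' t' s2)
  from WhileTrue.prems show ?case
  proof (rule exec_elims)
    fix a r b' assume u: "u = Suc (a + b')" and 1: "exec w P s a r"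
      and 2: "exec w (While b P) r b' s''"
    have "a = t \<and> r = s'" by (rule WhileTrue.IH(1)[OF 1])
    with 2 have "b' = t' \<and> s'' = s2" by (intro WhileTrue.IH(2)) simp
    with u \<open>a = t \<and> r = s'\<close> show ?thesis by simp
  qed (use WhileTrue.hyps in simp)
next
  case (WhileFalse b s P)
  from WhileFalse.prems show ?case
    by (rule exec_elims) (use WhileFalse.hyps in auto)
qed (auto elim: exec_elims)

text \<open>
  Initially the text array holds \<open>T\<close>, word register 0 holds the length of \<open>T\<close>, and all other
  registers have arbitrary contents. The bit array has exactly the length of the output, its contents
  are arbitrary, and its length is not given to the program.
\<close>

definition initial :: "nat \<Rightarrow> nat \<Rightarrow> 'a::linorder list \<Rightarrow> 'a state \<Rightarrow> bool" where
  "initial w k T s \<longleftrightarrow>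
     length (wreg s) = k \<and> (\<forall>v \<in> set (wreg s). v < 2 ^ w) \<and> 0 < k \<and> wreg s ! 0 = length T \<and>
     length (sreg s) = k \<and> tarr s = T \<and> length (barr s) = length (compressed_lcp T)"

end

theory Submission
  imports Defs
begin

text \<open>
  The suffixes are inserted from the shortest to the longest: when the suffix \<open>U\<close> has been
  treated, its transform occupies the place of \<open>U\<close> in the text array and its compressed LCP array is
  a prefix of the bit array. Prepending a symbol \<open>c\<close> puts \<open>c\<close> in place of the sentinel at
  position \<open>pos\<close> and inserts a new sentinel at position \<open>rank\<close>. The lengths of the common
  prefixes of \<open>c # U\<close> with its two neighbours exceed by one the common prefixes of
  \<open>U\<close> with the nearest suffixes preceded by \<open>c\<close> on either side of \<open>pos\<close>, and these are
  range minima of the old LCP array, so a single scan finds all four numbers.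

  The entry at \<open>rank\<close> is the smaller one of the two new entries, so exactly one code is
  added, and the old codes behind it move by its length. The move is made in chunks as
  long as the longest code written so far, which bounds the number of chunks by the number of
  entries and makes every insertion linear.

  For the average case, the code length is at most logarithmic in the entry, and the
  logarithm is replaced by its tangent at the bound on the expectation.
\<close>

section \<open>Longest common prefixes in the suffix array\<close>

abbreviation lcp :: "'a list \<Rightarrow> 'a list \<Rightarrow> nat" where
  "lcp x y \<equiv> length (longest_common_prefix x y)"

lemma lcp_commute: "lcp x y = lcp y x"
  by (induction x y rule: longest_common_prefix.induct) auto

lemma lcp_le: "lcp x y \<le> length x" "lcp x y \<le> length y"
  by (simp_all add: prefix_length_le longest_common_prefix_prefix1 longest_common_prefix_prefix2)

text \<open>A list between two lists with the same head has that head too; between two different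
  heads it differs from one of them. Iterated along the suffix array, this turns common prefixes
  into range minima.\<close>

lemma lcp_sorted:
  fixes x y z :: "'a::linorder list"
  assumes "x \<le> y" "y \<le> z"
  shows "lcp x z = min (lcp x y) (lcp y z)"
  using assms
proof (induction x z arbitrary: y rule: longest_common_prefix.induct)
  case (1 a x b z)
  then obtain e y' where "y = e # y'" by (cases y) auto
  with 1 show ?case by (auto split: if_splits)
next
  case ("2_1" z)
  then show ?case by simp
next
  case ("2_2" x)
  then show ?case by (cases y) auto
qed

text \<open>A strictly sorted enumeration of a finite set is unique, and suffixes of different
  lengths differ, so the sorted suffixes determine the positions.\<close>

lemma suffix_array_eqI:
  assumes "sorted_wrt (\<lambda>i j. drop i T < drop j T) xs" and "set xs = {0..<length T}"
  shows "suffix_array T = xs"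
proof -
  let ?f = "\<lambda>k. drop k T"
  have s: "set (suffix_array T) = {0..<length T}" by (simp add: suffix_array_def)
  have inj: "inj_on ?f {0..<length T}"
  proof (rule inj_onI)
    fix i j assume "i \<in> {0..<length T}" "j \<in> {0..<length T}" "drop i T = drop j T"
    then have "length T - i = length T - j" "i < length T" "j < length T"
      by (auto dest: arg_cong[of _ _ length])
    then show "i = j" by linarith
  qed
  have "sorted_wrt (<) (map ?f (suffix_array T))" "sorted_wrt (<) (map ?f xs)"
    using suffix_array_strictly_sorted[of T] assms(1) by (simp_all add: sorted_wrt_map)
  then have "map ?f (suffix_array T) = map ?f xs"
    by (intro sorted_distinct_set_unique) (simp_all add: s assms(2) strict_sorted_iff)
  then show ?thesis
    using inj s assms(2) by (metis Un_absorb map_inj_on)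
qed

lemma length_suffix_array [simp]: "length (suffix_array T) = length T"
  by (simp add: suffix_array_def)

lemma set_suffix_array [simp]: "set (suffix_array T) = {0..<length T}"
  by (simp add: suffix_array_def)

lemma length_bwt [simp]: "length (bwt d T) = length T"
  by (simp add: bwt_def)

lemma length_lcp_array [simp]: "length (lcp_array T) = length T"
  by (simp add: lcp_array_def)

section \<open>The place of a prepended text among the old suffixes\<close>

locale insertion =
  fixes d c :: "'a::linorder" and U :: "'a list"
  assumes nonempty: "U \<noteq> []" and last: "last U = d"
    and butlast: "\<And>x. x \<in> set (butlast U) \<Longrightarrow> d < x" and c: "d < c"
begin

definition sa where "sa i = suffix_array U ! i"
definition suf where "suf i = drop (sa i) U"
definition B where "B i = bwt d U ! i"
definition pos where "pos = (THE i. i < length U \<and> sa i = 0)"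
text \<open>Apart from \<open>pos\<close>, where the sentinel stands for the suffix
  \<open>[d]\<close>, entry \<open>i\<close> stands for the suffix \<open>B i # suf i\<close>.
  Comparing it with \<open>c # U\<close> means comparing \<open>B i\<close> with \<open>c\<close>
  and, on a tie, \<open>suf i\<close> with \<open>U\<close>, that is, \<open>i\<close> with
  \<open>pos\<close>.\<close>

definition below where "below = {i. i < length U \<and> (B i < c \<or> B i = c \<and> i < pos)}"
definition rank where "rank = card below"

lemma sa_less: "i < length U \<Longrightarrow> sa i < length U"
  using nth_mem[of i "suffix_array U"] by (simp add: sa_def)

lemma sa_surj: "j < length U \<Longrightarrow> \<exists>i<length U. sa i = j"
  using in_set_conv_nth[of j "suffix_array U"] by (auto simp: sa_def)

lemma suf_mono: "i < j \<Longrightarrow> j < length U \<Longrightarrow> suf i < suf j"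
  using sorted_wrt_nth_less[OF suffix_array_strictly_sorted[of U], of i j]
  by (simp add: suf_def sa_def)

lemma suf_less_iff: "i < length U \<Longrightarrow> j < length U \<Longrightarrow> suf i < suf j \<longleftrightarrow> i < j"
  by (metis suf_mono less_asym linorder_neqE_nat order_less_irrefl)

lemma sa_inj: "i < length U \<Longrightarrow> j < length U \<Longrightarrow> sa i = sa j \<Longrightarrow> i = j"
  by (metis suf_less_iff suf_def linorder_neqE_nat order_less_irrefl)

lemma pos: "pos < length U" "sa pos = 0"
proof -
  have "\<exists>!i. i < length U \<and> sa i = 0"
    using sa_surj[of 0] sa_inj nonempty by (metis length_greater_0_conv)
  from theI'[OF this] show "pos < length U" "sa pos = 0" by (simp_all add: pos_def)
qed

lemma suf_pos: "suf pos = U"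
  by (simp add: suf_def pos)

lemma B_pos: "B pos = d"
  using pos by (simp add: B_def bwt_def sa_def)

lemma U_nth_last: "U ! (length U - 1) = d"
  using last nonempty by (simp add: last_conv_nth)

lemma U_nth: "j + 1 < length U \<Longrightarrow> d < U ! j"
  using butlast[of "U ! j"] nth_mem[of j "butlast U"] by (simp add: nth_butlast)

text \<open>Only the whole text has no symbol in front of it. Any other suffix is preceded by a
  symbol that is not the last one and hence exceeds the sentinel.\<close>

lemma B_nonpos:
  assumes "i < length U" "i \<noteq> pos"
  obtains j where "sa i = Suc j" "Suc j < length U" "B i = U ! j" "drop j U = B i # suf i" "d < B i"
proof -
  have "sa i \<noteq> 0" using assms sa_inj pos by metis
  then obtain j where j: "sa i = Suc j" by (cases "sa i") auto
  then have "Suc j < length U" using sa_less assms by metis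
  moreover have "B i = U ! j" using j assms by (simp add: B_def bwt_def sa_def)
  moreover have "drop j U = B i # suf i"
    using j calculation by (metis Cons_nth_drop_Suc Suc_lessD suf_def)
  moreover have "d < B i" using calculation U_nth[of j] by simp
  ultimately show ?thesis using that j by blast
qed

text \<open>By the sentinel, \<open>B i\<close> is the symbol of \<open>U\<close> at \<open>prev i\<close> for the position of the sentinel, too.\<close>

definition prev where "prev i = (if sa i = 0 then length U - 1 else sa i - 1)"

lemma prev_pos: "prev pos = length U - 1"
  by (simp add: prev_def pos)

lemma prev_bij: "bij_betw prev {0..<length U} {0..<length U}"
proof -
  have "inj_on prev {0..<length U}"
  proof (rule inj_onI)
    fix i j assume *: "i \<in> {0..<length U}" "j \<in> {0..<length U}" "prev i = prev j"
    then have "sa i < length U" "sa j < length U" using sa_less by auto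
    then have "sa i = sa j" using * by (auto simp: prev_def split: if_splits)
    then show "i = j" using sa_inj * by auto
  qed
  moreover have "prev ` {0..<length U} \<subseteq> {0..<length U}"
    using sa_less nonempty by (force simp: prev_def)
  ultimately show ?thesis
    by (simp add: bij_betw_def endo_inj_surj)
qed

text \<open>At \<open>pos\<close> the suffix in question is \<open>[d]\<close>, which is smaller
  because \<open>d < c\<close>. Elsewhere equal heads leave the comparison of \<open>suf i\<close>
  with \<open>U = suf pos\<close>.\<close>

lemma below_iff:
  assumes "i < length U"
  shows "i \<in> below \<longleftrightarrow> drop (prev i) U < c # U"
proof (cases "i = pos")
  case True
  then have "drop (prev i) U = [d]"
    using nonempty U_nth_last Cons_nth_drop_Suc[of "length U - 1" U] by (simp add: prev_pos)
  then show ?thesis using True assms c by (simp add: below_def B_pos)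
next
  case False
  with assms obtain j where j: "sa i = Suc j" "drop j U = B i # suf i" by (rule B_nonpos)
  then have "prev i = j" by (simp add: prev_def)
  then show ?thesis
    using j assms suf_less_iff[of i pos] pos by (auto simp: below_def suf_pos)
qed

text \<open>Both sides count the suffixes of \<open>U\<close> below \<open>c # U\<close>, once
  indexed through \<open>prev\<close> and once through \<open>sa\<close>, and both maps are
  bijections.\<close>

lemma rank_eq: "rank = card {i \<in> {0..<length U}. suf i < c # U}"
proof -
  have *: "below = {i \<in> {0..<length U}. i \<in> below}" by (auto simp: below_def)
  have **: "bij_betw prev {i \<in> {0..<length U}. i \<in> below} {j \<in> {0..<length U}. drop j U < c # U}"
    using prev_bij by (rule bij_betw_Collect) (simp add: below_iff)
  have *: "rank = card {j \<in> {0..<length U}. drop j U < c # U}"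
    unfolding rank_def by (subst *) (rule bij_betw_same_card[OF **])
  have "inj_on sa {0..<length U}" using sa_inj by (auto intro!: inj_onI)
  moreover from this have "sa ` {0..<length U} = {0..<length U}"
    using sa_less by (intro endo_inj_surj) auto
  ultimately have "bij_betw sa {0..<length U} {0..<length U}"
    by (simp add: bij_betw_def)
  then have "bij_betw sa {i \<in> {0..<length U}. suf i < c # U} {j \<in> {0..<length U}. drop j U < c # U}"
    by (rule bij_betw_Collect) (simp add: suf_def)
  from bij_betw_same_card[OF this] * show ?thesis by simp
qed

text \<open>The suffixes are sorted, so the entries below \<open>c # U\<close> form an initial
  segment, whose length is its cardinality \<open>rank\<close>.\<close>

lemma suf_less_new: "i < length U \<Longrightarrow> suf i < c # U \<longleftrightarrow> i < rank"
proof -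
  let ?A = "{i \<in> {0..<length U}. suf i < c # U}"
  have "\<exists>k. ?A = {0..<k}"
  proof (cases "?A = {}")
    case False
    have "?A = {0..<Suc (Max ?A)}"
    proof -
      have *: "finite ?A" by simp
      have "Max ?A \<in> ?A" using Max_in[OF * False] .
      moreover have "i \<in> ?A" if "i \<le> Max ?A" for i
        using that calculation suf_mono[of i "Max ?A"]
        by (cases "i = Max ?A") auto
      moreover have "i \<le> Max ?A" if "i \<in> ?A" for i using * that by simp
      ultimately have "x \<in> ?A \<longleftrightarrow> x \<le> Max ?A" for x by blast
      then show ?thesis by (intro set_eqI) (simp only: atLeastLessThan_iff less_Suc_eq_le le0 simp_thms)
    qed
    then show ?thesis by blast
  next
    case True
    then have "?A = {0..<0}" by simp
    then show ?thesis by blast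
  qed
  then obtain k where k: "?A = {0..<k}" by blast
  then have "rank = k" using rank_eq by simp
  moreover assume "i < length U"
  ultimately show ?thesis using k by (auto simp: set_eq_iff)
qed

lemma new_less_suf:
  assumes "i < length U" "rank \<le> i"
  shows "c # U < suf i"
proof -
  have "suf i \<noteq> c # U" by (auto simp: suf_def dest: arg_cong[of _ _ length])
  then show ?thesis using assms suf_less_new[of i] by simp
qed

lemma rank_le: "rank \<le> length U"
  using card_mono[of "{..<length U}" below] by (auto simp: rank_def below_def)

text \<open>The sentinel entry always lies in \<open>below\<close>. Hence the new suffix always has
  a left neighbour, and only the right one may be missing.\<close>

lemma rank_pos: "0 < rank"
  using B_pos c pos by (auto simp: rank_def below_def card_gt_0_iff)

text \<open>Prepending moves each old suffix by one position without changing their order; the only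
  new suffix goes behind the \<open>rank\<close> smaller ones.\<close>

lemma suffix_array_Cons:
  "suffix_array (c # U)
   = take rank (map Suc (suffix_array U)) @ 0 # drop rank (map Suc (suffix_array U))" (is "_ = ?xs")
proof (rule suffix_array_eqI)
  have len: "length ?xs = Suc (length U)" using rank_le by simp
  have nth: "drop (?xs ! i) (c # U) =
      (if i < rank then suf i else if i = rank then c # U else suf (i - 1))" if "i \<le> length U" for i
    using that rank_le by (auto simp: nth_append nth_Cons' suf_def sa_def)
  show "sorted_wrt (\<lambda>i j. drop i (c # U) < drop j (c # U)) ?xs"
    unfolding sorted_wrt_iff_nth_less
  proof (intro allI impI)
    fix i j assume ij: "i < j" "j < length ?xs"
    then have l: "i < length U" "j \<le> length U" using len by linarith+
    then have "i \<le> length U" by simp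
    consider "j < rank" | "i < rank" "j = rank" | "i < rank" "rank < j" | "i = rank" | "rank < i"
      by linarith
    then have "(if i < rank then suf i else if i = rank then c # U else suf (i - 1))
      < (if j < rank then suf j else if j = rank then c # U else suf (j - 1))"
    proof cases
      case 1
      then show ?thesis using ij rank_le suf_mono[of i j] by simp
    next
      case 2
      then show ?thesis using l suf_less_new[of i] by simp
    next
      case 3
      then have "suf i < suf (j - 1)" using l by (intro suf_mono) auto
      then show ?thesis using 3 by simp
    next
      case 4
      then have "c # U < suf (j - 1)" using l ij by (intro new_less_suf) auto
      then show ?thesis using 4 ij by simp
    next
      case 5
      then have "suf (i - 1) < suf (j - 1)" using l ij by (intro suf_mono) auto
      then show ?thesis using 5 ij by simp
    qed
    then show "drop (?xs ! i) (c # U) < drop (?xs ! j) (c # U)"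
      unfolding nth[OF l(2)] nth[OF \<open>i \<le> length U\<close>] .
  qed
  have "set ?xs = insert 0 (set (map Suc (suffix_array U)))"
    by (metis Un_insert_right append_take_drop_id list.simps(15) set_append)
  then show "set ?xs = {0..<length (c # U)}"
    by (simp add: atLeast0LessThan lessThan_Suc_eq_insert_0)
qed

text \<open>The old whole text is now preceded by \<open>c\<close>, which replaces the sentinel at
  \<open>pos\<close>; the new whole text brings its own sentinel to \<open>rank\<close>. All other
  preceding symbols stay.\<close>

lemma bwt_Cons:
  "bwt d (c # U) = take rank ((bwt d U)[pos := c]) @ d # drop rank ((bwt d U)[pos := c])"
proof -
  have "map (\<lambda>k. if k \<noteq> 0 then (c # U) ! (k - 1) else d) (map Suc (suffix_array U))
      = (bwt d U)[pos := c]"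
  proof (rule nth_equalityI)
    fix i assume "i < length (map (\<lambda>k. if k \<noteq> 0 then (c # U) ! (k - 1) else d) (map Suc (suffix_array U)))"
    then have i: "i < length U" by simp
    show "map (\<lambda>k. if k \<noteq> 0 then (c # U) ! (k - 1) else d) (map Suc (suffix_array U)) ! i
      = (bwt d U)[pos := c] ! i"
    proof (cases "i = pos")
      case True
      then show ?thesis using pos by (simp add: sa_def)
    next
      case False
      with i obtain j where "sa i = Suc j" by (rule B_nonpos)
      then show ?thesis using i False by (simp add: bwt_def sa_def)
    qed
  qed simp
  then show ?thesis
    unfolding bwt_def[of d "c # U"] suffix_array_Cons map_append list.map
      take_map[symmetric] drop_map[symmetric] by simp
qed

section \<open>The LCP array after the insertion\<close>

definition left_lcp where "left_lcp = lcp (suf (rank - 1)) (c # U)"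
text \<open>The value \<open>0\<close> for a missing neighbour agrees with the empty case of
  \<open>right_max\<close> and makes \<open>max left_lcp right_lcp\<close> equal to
  \<open>left_lcp\<close>.\<close>

definition right_lcp where "right_lcp = (if rank < length U then lcp (c # U) (suf rank) else 0)"

lemma lcp_array_nth:
  "i < length U \<Longrightarrow> lcp_array U ! i = (if i = 0 then 0 else lcp (suf (i - 1)) (suf i))"
  by (simp add: lcp_array_def suf_def sa_def lcp_commute)

text \<open>The new suffix separates one pair of neighbours, so the entry at \<open>rank\<close>
  gives way to two; at the end of the array there is no such pair, and one entry is
  appended.\<close>

lemma lcp_array_Cons:
  "lcp_array (c # U) = take rank (lcp_array U) @ left_lcp #
     (if rank < length U then right_lcp # drop (Suc rank) (lcp_array U) else [])" (is "_ = ?ys")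
proof (rule nth_equalityI)
  show len: "length (lcp_array (c # U)) = length ?ys" using rank_le by (auto simp: min_def)
  fix i assume "i < length (lcp_array (c # U))"
  then have i: "i \<le> length U" by simp
  have sa': "drop (suffix_array (c # U) ! i) (c # U) =
      (if i < rank then suf i else if i = rank then c # U else suf (i - 1))" if "i \<le> length U" for i
    using that rank_le unfolding suffix_array_Cons by (auto simp: nth_append nth_Cons' suf_def sa_def)
  have l: "lcp_array (c # U) ! i = (if i = 0 then 0 else
      lcp (drop (suffix_array (c # U) ! (i - 1)) (c # U)) (drop (suffix_array (c # U) ! i) (c # U)))"
    using i by (simp add: lcp_array_def lcp_commute del: drop_Suc_Cons upt_Suc)
  consider "i < rank" | "i = rank" | "i = Suc rank" | "Suc rank < i" by linarith
  then show "lcp_array (c # U) ! i = ?ys ! i"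
  proof cases
    case 1
    then show ?thesis using i rank_le by (simp add: l sa' nth_append lcp_array_nth)
  next
    case 2
    then show ?thesis unfolding l using i rank_le rank_pos by (simp add: sa' nth_append left_lcp_def)
  next
    case 3
    then show ?thesis unfolding l using i rank_le rank_pos by (simp add: sa' nth_append right_lcp_def)
  next
    case 4
    then obtain t where "i = Suc (Suc (rank + t))" using less_iff_Suc_add by auto
    then show ?thesis unfolding l using i rank_pos
      by (simp add: sa' nth_append lcp_array_nth)
  qed
qed

text \<open>\<open>c # U\<close> lies between the neighbours that it separates, so
  \<open>lcp_sorted\<close> applies. One of the new entries is thus the old one, and only the other
  costs additional bits.\<close>

lemma lcp_array_rank:
  "rank < length U \<Longrightarrow> lcp_array U ! rank = min left_lcp right_lcp"
  using rank_pos suf_less_new[of "rank - 1"] new_less_suf[of rank]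
    lcp_sorted[of "suf (rank - 1)" "c # U" "suf rank"]
  by (simp add: lcp_array_nth left_lcp_def right_lcp_def less_imp_le)

lemma lcp_suf_step:
  assumes "i \<le> j" "Suc j < length U"
  shows "lcp (suf i) (suf (Suc j)) = min (lcp (suf i) (suf j)) (lcp_array U ! Suc j)"
proof -
  have "suf i \<le> suf j" "suf j \<le> suf (Suc j)"
    using assms suf_mono[of i j] suf_mono[of j "Suc j"] by (auto simp: le_less)
  from lcp_sorted[OF this] show ?thesis using assms by (simp add: lcp_array_nth)
qed

text \<open>A common prefix as long as \<open>U\<close> would make both neighbours equal to
  \<open>U\<close>. The strict bound makes an entry plus one fit wherever the length of
  \<open>U\<close> fits.\<close>

lemma lcp_array_less:
  assumes "i < length U"
  shows "lcp_array U ! i < length U"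
proof (cases "i = 0")
  case False
  have ne: "suf (i - 1) \<noteq> suf i" using False assms suf_mono[of "i - 1" i] by auto
  show ?thesis
  proof (rule ccontr)
    assume "\<not> ?thesis"
    then have "length U \<le> lcp (suf (i - 1)) (suf i)" using False assms by (simp add: lcp_array_nth)
    then have "length U \<le> length (suf (i - 1))" "length U \<le> length (suf i)"
      using lcp_le[of "suf (i - 1)" "suf i"] by auto
    then have "sa (i - 1) = 0" "sa i = 0" using nonempty
      by (auto simp: suf_def simp flip: length_greater_0_conv)
    then show False using ne by (simp add: suf_def)
  qed
qed (use assms in \<open>simp add: lcp_array_nth\<close>)

section \<open>Both new entries by a single pass over the old arrays\<close>

definition left_max where
  "left_max i = Max (insert 0 ((\<lambda>q. Suc (lcp (suf q) (suf i))) ` {q. q < i \<and> B q = c}))"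
text \<open>In \<open>left_max\<close> the reference suffix is the current one and moves along; here
  it is the fixed \<open>suf pos\<close>. The successor counts the common \<open>c\<close>, and the
  inserted \<open>0\<close> stands for the absence of a candidate.\<close>

definition right_max where
  "right_max i = Max (insert 0 ((\<lambda>q. Suc (lcp (suf pos) (suf q))) ` {q. pos < q \<and> q < i \<and> B q = c}))"

lemma left_max_0: "left_max 0 = 0"
  by (simp add: left_max_def)

text \<open>Advancing the reference suffix caps every candidate by
  \<open>Suc (lcp_array U ! Suc i)\<close>; the cap is monotone and so commutes with
  \<open>Max\<close>. A new candidate at \<open>i\<close> attains the cap and therefore
  wins.\<close>

lemma left_max_Suc:
  assumes "Suc i < length U"
  shows "left_max (Suc i) = (if B i = c then Suc (lcp_array U ! Suc i)
    else min (left_max i) (Suc (lcp_array U ! Suc i)))"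
proof -
  let ?e = "lcp_array U ! Suc i"
  let ?Q = "{q. q < i \<and> B q = c}"
  have *: "(\<lambda>q. Suc (lcp (suf q) (suf (Suc i)))) ` ?Q
      = (\<lambda>x. min x (Suc ?e)) ` (\<lambda>q. Suc (lcp (suf q) (suf i))) ` ?Q"
    unfolding image_image using assms by (intro image_cong) (simp_all add: lcp_suf_step)
  have "Max (insert 0 ((\<lambda>q. Suc (lcp (suf q) (suf (Suc i)))) ` ?Q)) =
      Max ((\<lambda>x. min x (Suc ?e)) ` (insert 0 ((\<lambda>q. Suc (lcp (suf q) (suf i))) ` ?Q)))"
    by (simp only: * image_insert min_0L)
  also have "\<dots> = min (left_max i) (Suc ?e)"
    unfolding left_max_def by (subst mono_Max_commute[symmetric]) (auto intro: monoI)
  finally have 1: "Max (insert 0 ((\<lambda>q. Suc (lcp (suf q) (suf (Suc i)))) ` ?Q))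
      = min (left_max i) (Suc ?e)" .
  show ?thesis
  proof (cases "B i = c")
    case True
    then have "{q. q < Suc i \<and> B q = c} = insert i ?Q" by (auto simp: less_Suc_eq)
    then have "left_max (Suc i) = Max (insert (Suc (lcp (suf i) (suf (Suc i))))
        (insert 0 ((\<lambda>q. Suc (lcp (suf q) (suf (Suc i)))) ` ?Q)))"
      by (simp add: left_max_def insert_commute)
    also have "\<dots> = max (Suc ?e) (min (left_max i) (Suc ?e))"
      by (subst Max_insert) (use 1 assms in \<open>auto simp: lcp_array_nth\<close>)
    finally show ?thesis using True by simp
  next
    case False
    then have "{q. q < Suc i \<and> B q = c} = ?Q" by (auto simp: less_Suc_eq)
    then show ?thesis using False 1 by (simp add: left_max_def)
  qed
qed

lemma right_max_Suc:
  "right_max (Suc i) = (if pos < i \<and> B i = c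
     then max (right_max i) (Suc (lcp (suf pos) (suf i))) else right_max i)"
proof (cases "pos < i \<and> B i = c")
  case True
  then have "{q. pos < q \<and> q < Suc i \<and> B q = c} = insert i {q. pos < q \<and> q < i \<and> B q = c}"
    by (auto simp: less_Suc_eq)
  then show ?thesis using True
    by (simp add: right_max_def insert_commute[of 0] max.commute)
next
  case False
  then have "{q. pos < q \<and> q < Suc i \<and> B q = c} = {q. pos < q \<and> q < i \<and> B q = c}"
    by (auto simp: less_Suc_eq)
  then show ?thesis using False by (simp only: right_max_def if_False)
qed

lemma right_max_le_pos: "i \<le> Suc pos \<Longrightarrow> right_max i = 0"
proof -
  assume "i \<le> Suc pos"
  then have *: "{q. pos < q \<and> q < i \<and> B q = c} = {}" by auto
  show ?thesis unfolding right_max_def * by simp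
qed

text \<open>A suffix with head \<open>c\<close> is not the last one, so its tail is a proper suffix
  of \<open>U\<close>, and the transform shows \<open>c\<close> at the entry of the tail. The
  converse is \<open>c_suf\<close>.\<close>

lemma suf_Cons_c:
  assumes "i < length U" "suf i = c # xs"
  obtains q where "q < length U" "B q = c" "suf q = xs" "q \<noteq> pos"
proof -
  have "Suc (sa i) < length U"
  proof (rule ccontr)
    assume "\<not> ?thesis"
    then have "sa i = length U - 1" using sa_less assms(1) by force
    then have "suf i ! 0 = d" using U_nth_last nonempty by (simp add: suf_def)
    then show False using assms c by simp
  qed
  then obtain q where q: "q < length U" "sa q = Suc (sa i)" using sa_surj by blast
  have "suf i = U ! sa i # suf q"
    using q by (metis Cons_nth_drop_Suc suf_def assms(1) sa_less)
  moreover have "B q = U ! sa i" using q by (simp add: B_def bwt_def sa_def)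
  moreover have "q \<noteq> pos" using q pos by auto
  ultimately show ?thesis using that[of q] q assms by auto
qed

lemma c_suf:
  assumes "q < length U" "B q = c"
  obtains i where "i < length U" "suf i = c # suf q"
proof -
  have "q \<noteq> pos" using assms B_pos c by auto
  with assms(1) obtain j where "Suc j < length U" "drop j U = B q # suf q" by (rule B_nonpos)
  with sa_surj[of j] show ?thesis using that assms(2) by (auto simp: suf_def)
qed

text \<open>For \<open>q < pos\<close> the suffix \<open>c # suf q\<close> lies at or before
  \<open>rank - 1\<close>, so by \<open>lcp_sorted\<close> it shares no more with
  \<open>c # U\<close> than the left neighbour does. If that neighbour shares anything, its head is
  \<open>c\<close> and its tail is a candidate.\<close>

lemma left_lcp_eq: "left_lcp = left_max pos"
  unfolding left_max_def
proof (rule Max_eqI[symmetric])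
  fix y assume "y \<in> insert 0 ((\<lambda>q. Suc (lcp (suf q) (suf pos))) ` {q. q < pos \<and> B q = c})"
  then consider "y = 0" | q where "q < pos" "B q = c" "y = Suc (lcp (suf q) (suf pos))" by auto
  then show "y \<le> left_lcp"
  proof cases
    case (2 q)
    then have q: "q < length U" using pos by simp
    with 2 obtain i where i: "i < length U" "suf i = c # suf q" using c_suf by blast
    have "suf q < U" using suf_mono[of q pos] 2 pos suf_pos by simp
    then have "suf i < c # U" using i by simp
    then have ir: "i < rank" using suf_less_new[OF i(1)] by blast
    then have "suf i \<le> suf (rank - 1)"
      using suf_mono[of i "rank - 1"] rank_le by (cases "i = rank - 1") (auto simp: less_imp_le)
    moreover have "suf (rank - 1) \<le> c # U"
      using suf_less_new[of "rank - 1"] ir rank_le by (simp add: less_imp_le)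
    ultimately have "lcp (suf i) (c # U) \<le> left_lcp"
      using lcp_sorted[of "suf i" "suf (rank - 1)" "c # U"] by (simp add: left_lcp_def)
    then show ?thesis using 2 i suf_pos by simp
  qed simp
next
  have r: "rank - 1 < length U" "suf (rank - 1) < c # U"
    using rank_pos rank_le suf_less_new[of "rank - 1"] by auto
  show "left_lcp \<in> insert 0 ((\<lambda>q. Suc (lcp (suf q) (suf pos))) ` {q. q < pos \<and> B q = c})"
  proof (cases "left_lcp = 0")
    case False
    then obtain xs where xs: "suf (rank - 1) = c # xs"
      unfolding left_lcp_def by (cases "suf (rank - 1)") (auto split: if_splits)
    with r(1) obtain q where q: "q < length U" "B q = c" "suf q = xs" "q \<noteq> pos" by (rule suf_Cons_c)
    then have "suf q < suf pos" using r xs suf_pos by simp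
    then have "q < pos" using suf_less_iff[OF q(1) pos(1)] by blast
    then show ?thesis using q xs suf_pos by (auto simp: left_lcp_def)
  qed simp
qed simp

text \<open>Symmetric to \<open>left_lcp_eq\<close>. A candidate beyond \<open>pos\<close> yields a
  suffix at or behind \<open>rank\<close>, which shows that the right neighbour exists.\<close>

lemma right_lcp_eq: "right_lcp = right_max (length U)"
  unfolding right_max_def
proof (rule Max_eqI[symmetric])
  fix y assume "y \<in> insert 0 ((\<lambda>q. Suc (lcp (suf pos) (suf q))) ` {q. pos < q \<and> q < length U \<and> B q = c})"
  then consider "y = 0" | q where "pos < q" "q < length U" "B q = c" "y = Suc (lcp (suf pos) (suf q))"
    by auto
  then show "y \<le> right_lcp"
  proof cases
    case (2 q)
    then obtain i where i: "i < length U" "suf i = c # suf q" using c_suf by blast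
    have "U < suf q" using suf_mono[of pos q] 2 suf_pos by simp
    then have "\<not> suf i < c # U" using i by simp
    then have ir: "rank \<le> i" using suf_less_new[OF i(1)] by linarith
    then have "suf rank \<le> suf i"
      using suf_mono[of rank i] i by (cases "i = rank") auto
    moreover have "c # U \<le> suf rank"
      using new_less_suf[of rank] ir i by (simp add: less_imp_le)
    ultimately have "lcp (c # U) (suf i) \<le> right_lcp"
      using ir i lcp_sorted[of "c # U" "suf rank" "suf i"] by (simp add: right_lcp_def)
    then show ?thesis using 2 i suf_pos by simp
  qed simp
next
  show "right_lcp \<in> insert 0 ((\<lambda>q. Suc (lcp (suf pos) (suf q))) ` {q. pos < q \<and> q < length U \<and> B q = c})"
  proof (cases "right_lcp = 0")
    case False
    then have r: "rank < length U" by (auto simp: right_lcp_def split: if_splits)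
    then have r2: "c # U < suf rank" using new_less_suf by simp
    from False r obtain xs where xs: "suf rank = c # xs"
      unfolding right_lcp_def by (cases "suf rank") (auto split: if_splits)
    with r(1) obtain q where q: "q < length U" "B q = c" "suf q = xs" "q \<noteq> pos" by (rule suf_Cons_c)
    then have "suf pos < suf q" using r2 xs suf_pos by simp
    then have "pos < q" using suf_less_iff[OF pos(1) q(1)] by blast
    then show ?thesis using q xs suf_pos r by (auto simp: right_lcp_def)
  qed simp
qed simp

end

section \<open>Weakest preconditions\<close>

text \<open>Termination is part of the meaning, and the postcondition sees the exact number of
  steps. Since \<open>exec\<close> is deterministic, the existential quantifier describes the only
  run.\<close>

definition wp :: "nat \<Rightarrow> prog \<Rightarrow> 'a::linorder state \<Rightarrow> (nat \<Rightarrow> 'a state \<Rightarrow> bool) \<Rightarrow> bool" where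
  "wp w P s Q \<longleftrightarrow> (\<exists>t s'. exec w P s t s' \<and> Q t s')"

lemma wp_mono: "wp w P s Q \<Longrightarrow> (\<And>t s'. Q t s' \<Longrightarrow> R t s') \<Longrightarrow> wp w P s R"
  by (auto simp: wp_def)

text \<open>Keeps the simplifier from running the rest of a program on an unknown state.\<close>

lemma wp_weak_cong [cong]: "P = P' \<Longrightarrow> s = s' \<Longrightarrow> wp w P s Q \<longleftrightarrow> wp w P' s' Q"
  by simp

lemma wp_Skip [simp]: "wp w Skip s Q \<longleftrightarrow> Q 0 s"
  by (auto simp: wp_def intro: exec.Skip elim: exec_elims)

lemma wp_Instr: "wp w (Instr i) s Q \<longleftrightarrow> (\<exists>s'. step w i s = Some s' \<and> Q 1 s')"
  unfolding wp_def by (auto elim!: exec_elims) (metis One_nat_def exec.Instr)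

lemma wp_Seq [simp]:
  "wp w (Seq P R) s Q \<longleftrightarrow> wp w P s (\<lambda>t s'. wp w R s' (\<lambda>t' s''. Q (t + t') s''))"
  unfolding wp_def by (auto intro: exec.Seq elim!: exec_elims)

lemma wp_Cond:
  "wp w (Cond b P R) s Q \<longleftrightarrow>
   (\<exists>v. test_val b s = Some v \<and> wp w (if v then P else R) s (\<lambda>t s'. Q (1 + t) s'))"
  unfolding wp_def
  by (auto elim!: exec_elims) (metis (full_types) exec.CondTrue exec.CondFalse plus_1_eq_Suc)+

lemma wp_WTest [simp]:
  "wp w (Cond (WTest r x y) P R) s Q \<longleftrightarrow> x < length (wreg s) \<and> y < length (wreg s) \<and>
     wp w (if cmp_val r (wreg s ! x) (wreg s ! y) then P else R) s (\<lambda>t s'. Q (1 + t) s')"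
  by (auto simp: wp_Cond ex_bool_eq)

lemma wp_STest [simp]:
  "wp w (Cond (STest r x y) P R) s Q \<longleftrightarrow> x < length (sreg s) \<and> y < length (sreg s) \<and>
     wp w (if cmp_val r (sreg s ! x) (sreg s ! y) then P else R) s (\<lambda>t s'. Q (1 + t) s')"
  by (auto simp: wp_Cond ex_bool_eq)

lemma wp_instrs [simp]:
  "wp w (Instr (Const x v)) s Q \<longleftrightarrow>
     x < length (wreg s) \<and> Q 1 (s\<lparr>wreg := (wreg s)[x := v mod 2 ^ w]\<rparr>)"
  "wp w (Instr (Move x y)) s Q \<longleftrightarrow>
     x < length (wreg s) \<and> y < length (wreg s) \<and> Q 1 (s\<lparr>wreg := (wreg s)[x := wreg s ! y]\<rparr>)"
  "wp w (Instr (Arith f x y z)) s Q \<longleftrightarrow>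
     x < length (wreg s) \<and> y < length (wreg s) \<and> z < length (wreg s) \<and>
     Q 1 (s\<lparr>wreg := (wreg s)[x := binop_val w f (wreg s ! y) (wreg s ! z)]\<rparr>)"
  "wp w (Instr (LoadSym a x)) s Q \<longleftrightarrow>
     a < length (sreg s) \<and> x < length (wreg s) \<and> wreg s ! x < length (tarr s) \<and>
     Q 1 (s\<lparr>sreg := (sreg s)[a := tarr s ! (wreg s ! x)]\<rparr>)"
  "wp w (Instr (StoreSym x a)) s Q \<longleftrightarrow>
     a < length (sreg s) \<and> x < length (wreg s) \<and> wreg s ! x < length (tarr s) \<and>
     Q 1 (s\<lparr>tarr := (tarr s)[wreg s ! x := sreg s ! a]\<rparr>)"
  "wp w (Instr (LoadBits x p m)) s Q \<longleftrightarrow>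
     x < length (wreg s) \<and> p < length (wreg s) \<and> m < length (wreg s) \<and>
     wreg s ! m \<le> w \<and> wreg s ! p + wreg s ! m \<le> length (barr s) \<and>
     Q 1 (s\<lparr>wreg := (wreg s)
       [x := horner_sum of_bool 2 (take (wreg s ! m) (drop (wreg s ! p) (barr s)))]\<rparr>)"
  "wp w (Instr (StoreBits p m x)) s Q \<longleftrightarrow>
     x < length (wreg s) \<and> p < length (wreg s) \<and> m < length (wreg s) \<and>
     wreg s ! m \<le> w \<and> wreg s ! p + wreg s ! m \<le> length (barr s) \<and>
     Q 1 (s\<lparr>barr := overwrite (barr s) (wreg s ! p) (map (bit (wreg s ! x)) [0..<wreg s ! m])\<rparr>)"
  "wp w (Instr (Encode p x)) s Q \<longleftrightarrow>
     x < length (wreg s) \<and> p < length (wreg s) \<and> 1 \<le> wreg s ! x \<and>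
     wreg s ! p + length (elias_delta (wreg s ! x)) \<le> length (barr s) \<and>
     Q 1 (s\<lparr>barr := overwrite (barr s) (wreg s ! p) (elias_delta (wreg s ! x)),
            wreg := (wreg s)[p := (wreg s ! p + length (elias_delta (wreg s ! x))) mod 2 ^ w]\<rparr>)"
  by (auto simp: wp_Instr)

text \<open>Delta codes are prefix-free, so the code given at the pointer is the only one that can
  be read there.\<close>

lemma wp_Decode:
  assumes "x < length (wreg s)" "p < length (wreg s)" "1 \<le> l" "l < 2 ^ w"
    and "drop (wreg s ! p) (barr s) = elias_delta l @ zs"
  shows "wp w (Instr (Decode x p)) s Q \<longleftrightarrow>
    Q 1 (s\<lparr>wreg := (wreg s)[x := l, p := (wreg s ! p + length (elias_delta l)) mod 2 ^ w]\<rparr>)"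
proof -
  have "prefix (elias_delta l) (drop (wreg s ! p) (barr s))" using assms(5) by simp
  moreover from this have "(THE l. 1 \<le> l \<and> prefix (elias_delta l) (drop (wreg s ! p) (barr s))) = l"
    using assms(3) by (intro the_equality) (auto intro: elias_delta_prefix_free)
  ultimately show ?thesis using assms(1-4) by (auto simp: wp_Instr Let_def)
qed

text \<open>The number \<open>N\<close> of passes is known in advance and the invariant is indexed
  by the pass, so the induction goes downwards from \<open>N\<close>. Each pass costs the body and
  one test; the last summand is the failing test.\<close>

lemma wp_While:
  assumes "I 0 s"
    and "\<And>i s. i < N \<Longrightarrow> I i s \<Longrightarrow> test_val b s = Some True"
    and "\<And>i s. i < N \<Longrightarrow> I i s \<Longrightarrow> wp w P s (\<lambda>t s'. t \<le> C \<and> I (Suc i) s')"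
    and "\<And>s. I N s \<Longrightarrow> test_val b s = Some False"
  shows "wp w (While b P) s (\<lambda>t s'. t \<le> N * Suc C + 1 \<and> I N s')"
proof -
  have "wp w (While b P) s (\<lambda>t s'. t \<le> (N - i) * Suc C + 1 \<and> I N s')" if "I i s" "i \<le> N" for i s
    using that(2,1)
  proof (induction i arbitrary: s rule: inc_induct)
    case base
    with assms(4) show ?case by (auto simp: wp_def intro!: exec.WhileFalse exI)
  next
    case (step i)
    from assms(3)[OF step(2,4)] obtain t s' where 1: "exec w P s t s'" "t \<le> C" "I (Suc i) s'"
      by (auto simp: wp_def)
    from step(3)[OF this(3)] obtain t' s'' where 2: "exec w (While b P) s' t' s''"
      "t' \<le> (N - Suc i) * Suc C + 1" "I N s''" by (auto simp: wp_def)
    have "N - i = Suc (N - Suc i)" using step(2) by simp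
    then have "1 + t + t' \<le> (N - i) * Suc C + 1" using 1 2 by simp
    with exec.WhileTrue[OF assms(2)[OF step(2,4)] 1(1) 2(1)] 2(3) show ?case
      unfolding wp_def by blast
  qed
  \<comment> \<open>The weak congruence would block the rewriting of \<open>N - 0\<close> in the
    postcondition.\<close>
  from this[of 0 s] assms(1) show ?thesis by (simp cong del: wp_weak_cong)
qed

section \<open>Program blocks, minima, and arithmetic without overflow\<close>

fun block :: "prog list \<Rightarrow> prog" where
  "block [] = Skip"
| "block (P # Ps) = Seq P (block Ps)"

text \<open>Both branches execute one instruction, so that the running time does not depend on the state.\<close>

definition min_into :: "nat \<Rightarrow> nat \<Rightarrow> prog" where
  "min_into x y = Cond (WTest LT y x) (Instr (Move x y)) (Instr (Move x x))"
definition max_into :: "nat \<Rightarrow> nat \<Rightarrow> prog" where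
  "max_into x y = Cond (WTest LT x y) (Instr (Move x y)) (Instr (Move x x))"

lemma wp_min_into [simp]:
  "wp w (min_into x y) s Q \<longleftrightarrow> x < length (wreg s) \<and> y < length (wreg s) \<and>
     Q 2 (s\<lparr>wreg := (wreg s)[x := min (wreg s ! x) (wreg s ! y)]\<rparr>)"
  by (auto simp: min_into_def min_def numeral_2_eq_2 split: if_splits)

lemma wp_max_into [simp]:
  "wp w (max_into x y) s Q \<longleftrightarrow> x < length (wreg s) \<and> y < length (wreg s) \<and>
     Q 2 (s\<lparr>wreg := (wreg s)[x := max (wreg s ! x) (wreg s ! y)]\<rparr>)"
  by (auto simp: max_into_def max_def numeral_2_eq_2 split: if_splits)

text \<open>With \<open>binop_val_Sub\<close> it takes the place of the modular equations, which
  leave the simpset below: each use has to show that no overflow occurs.\<close>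

lemma binop_val_Add [simp]: "x + y < 2 ^ w \<Longrightarrow> binop_val w Add x y = x + y"
  by simp

lemma binop_val_Sub [simp]:
  assumes "y \<le> x" "x < 2 ^ w"
  shows "binop_val w Sub x y = x - y"
proof -
  have "(int x - int y) mod 2 ^ w = int (x - y)"
    using assms by (simp add: of_nat_diff mod_pos_pos_trivial)
      (metis (mono_tags) diff_ge_0_iff_ge less_imp_diff_less mod_pos_pos_trivial of_nat_diff of_nat_less_iff of_nat_numeral of_nat_power of_nat_le_iff)
  then show ?thesis by simp
qed

declare binop_val.simps(1,2) [simp del]

section \<open>Bit fields and codes\<close>

lemma length_overwrite [simp]: "p + length ys \<le> length xs \<Longrightarrow> length (overwrite xs p ys) = length xs"
  by (simp add: overwrite_def)

text \<open>Writes to adjacent fields, the rear one first, merge into one. This is the order in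
  which chunks are moved.\<close>

lemma overwrite_overwrite:
  assumes "p + length ys + length zs \<le> length xs"
  shows "overwrite (overwrite xs (p + length ys) zs) p ys = overwrite xs p (ys @ zs)"
  using assms by (simp add: overwrite_def add.assoc min_def)

lemma take_drop_overwrite:
  assumes "x + m \<le> p" "p \<le> length xs"
  shows "take m (drop x (overwrite xs p ys)) = take m (drop x xs)"
  using assms by (intro nth_equalityI) (auto simp: overwrite_def nth_append)

lemma map_bit_horner_sum:
  "map (bit (horner_sum of_bool 2 bs :: nat)) [0..<length bs] = bs"
  by (rule nth_equalityI) (simp_all add: bit_horner_sum_bit_iff)

definition codes :: "nat list \<Rightarrow> bool list" where
  "codes xs = concat (map (\<lambda>l. elias_delta (l + 1)) xs)"

lemma codes_simps [simp]:
  "codes [] = []" "codes (x # xs) = elias_delta (Suc x) @ codes xs" "codes (xs @ ys) = codes xs @ codes ys"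
  by (simp_all add: codes_def)

lemma compressed_lcp_codes: "compressed_lcp T = codes (lcp_array T)"
  by (simp add: compressed_lcp_def codes_def)

lemma codes_take_drop: "codes (take i xs) @ codes (drop i xs) = codes xs"
  by (simp flip: codes_simps(3))

lemma codes_nth:
  assumes "i < length xs"
  shows "codes xs = codes (take i xs) @ elias_delta (Suc (xs ! i)) @ codes (drop (Suc i) xs)"
  using id_take_nth_drop[OF assms] by (metis codes_simps(2,3))

lemma length_codes_take: "length (codes (take i xs)) \<le> length (codes xs)"
  by (metis codes_take_drop length_append le_add1)

lemma length_codes_take_Suc:
  "i < length xs \<Longrightarrow> length (codes (take (Suc i) xs))
     = length (codes (take i xs)) + length (elias_delta (Suc (xs ! i)))"
  by (simp add: take_Suc_conv_app_nth)

lemma length_codes_le: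
  "(\<And>x. x \<in> set xs \<Longrightarrow> length (elias_delta (Suc x)) \<le> m) \<Longrightarrow> length (codes xs) \<le> length xs * m"
  by (induction xs) (auto simp: add_le_mono)

section \<open>The scan\<close>

abbreviation (input) "r_len \<equiv> 0::nat"
abbreviation (input) "r_one \<equiv> 2::nat"
abbreviation (input) "r_zero \<equiv> 3::nat"
abbreviation (input) "r_start \<equiv> 4::nat"
abbreviation (input) "r_j \<equiv> 5::nat"
abbreviation (input) "r_code \<equiv> 6::nat"
abbreviation (input) "r_left \<equiv> 7::nat"
abbreviation (input) "r_right \<equiv> 8::nat"
abbreviation (input) "r_rank \<equiv> 9::nat"
abbreviation (input) "r_pos \<equiv> 10::nat"
abbreviation (input) "r_a \<equiv> 11::nat"
abbreviation (input) "r_b \<equiv> 12::nat"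
abbreviation (input) "r_ptr \<equiv> 13::nat"
abbreviation (input) "r_end \<equiv> 14::nat"
abbreviation (input) "r_chunk \<equiv> 15::nat"
abbreviation (input) "r_delta \<equiv> 16::nat"
abbreviation (input) "r_count \<equiv> 17::nat"
abbreviation (input) "r_tmp \<equiv> 18::nat"
abbreviation (input) "r_dest \<equiv> 19::nat"
abbreviation (input) "r_next \<equiv> 20::nat"
abbreviation (input) "s_new \<equiv> 2::nat"
abbreviation (input) "s_end \<equiv> 3::nat"
abbreviation (input) "s_cur \<equiv> 4::nat"
abbreviation (input) "regs \<equiv> 21::nat"

definition frame :: "nat set \<Rightarrow> nat set \<Rightarrow> 'a state \<Rightarrow> 'a state \<Rightarrow> bool" where
  "frame X Y s s' \<longleftrightarrow> length (wreg s') = length (wreg s) \<and> length (sreg s') = length (sreg s) \<and>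
     (\<forall>x. x \<notin> X \<longrightarrow> wreg s' ! x = wreg s ! x) \<and> (\<forall>a. a \<notin> Y \<longrightarrow> sreg s' ! a = sreg s ! a)"

text \<open>
  \<open>r_left\<close> is one plus the common prefix of the current suffix with the last one before it that is
  preceded by \<open>c\<close>, and \<open>0\<close> if there is none; \<open>r_right\<close> is \<open>0\<close> up to the sentinel
  and then one plus the common prefix with \<open>U\<close>. The length of the text stands for infinity in
  both minima.
\<close>

definition scan_body :: prog where
  "scan_body = block [
     Instr (Decode r_code r_ptr),
     min_into r_left r_code,
     min_into r_right r_code,
     Instr (LoadSym s_cur r_j),
     Cond (STest EQ s_cur s_end)
       (block [Instr (Arith Add r_rank r_rank r_one), Instr (Move r_pos r_j),
               Instr (Move r_a r_left), Instr (Move r_right r_len)])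
       (Cond (STest LT s_cur s_new)
         (Instr (Arith Add r_rank r_rank r_one))
         (Cond (STest EQ s_cur s_new)
           (Cond (WTest EQ r_right r_zero)
             (block [Instr (Arith Add r_rank r_rank r_one), Instr (Move r_left r_len)])
             (max_into r_b r_right))
           Skip)),
     Instr (Arith Add r_j r_j r_one)]"

definition scan :: prog where
  "scan = While (WTest LT r_j r_len) scan_body"

context insertion
begin

lemma B_neq: "i < length U \<Longrightarrow> i \<noteq> pos \<Longrightarrow> B i \<noteq> d"
  using B_nonpos by (metis order_less_irrefl)

text \<open>The bit array is read once, code by code, in step with the symbols of the transform. The
  running minima are capped by the decoded value before the symbol is inspected, so they then refer
  to the current suffix.\<close>

lemma wp_scan:
  fixes s0 :: "'a state"
  assumes len: "length (wreg s0) = regs" "length (sreg s0) = regs"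
    and n: "st + length U = n" "n < 2 ^ w"
    and regs: "wreg s0 ! r_len = n" "wreg s0 ! r_one = 1" "wreg s0 ! r_zero = 0" "wreg s0 ! r_j = st"
      "wreg s0 ! r_left = 0" "wreg s0 ! r_right = 0" "wreg s0 ! r_rank = 0" "wreg s0 ! r_b = 0"
      "wreg s0 ! r_ptr = 0" "sreg s0 ! s_new = c" "sreg s0 ! s_end = d"
    and tarr: "length (tarr s0) = n" "drop st (tarr s0) = bwt d U"
    and barr: "barr s0 = compressed_lcp U @ junk" "length (barr s0) < 2 ^ w"
  shows "wp w scan s0 (\<lambda>t s. t \<le> length U * 16 + 1 \<and>
    frame {r_j, r_code, r_left, r_right, r_rank, r_pos, r_a, r_b, r_ptr} {s_cur} s0 s \<and>
    tarr s = tarr s0 \<and> barr s = barr s0 \<and> wreg s ! r_rank = rank \<and> wreg s ! r_pos = st + pos \<and>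
    wreg s ! r_a = left_lcp \<and> wreg s ! r_b = right_lcp \<and>
    wreg s ! r_ptr = length (compressed_lcp U))"
proof -
  let ?L = "lcp_array U"
  let ?F = "frame {r_j, r_code, r_left, r_right, r_rank, r_pos, r_a, r_b, r_ptr} {s_cur} s0"
  \<comment> \<open>A register set to the length of the text becomes correct only after the cap of
    the next pass, hence the \<open>min\<close> with the coming entry; past the end there is no such
    entry. A positive \<open>r_right\<close> marks that the sentinel has been passed.\<close>
  define I where "I i s \<longleftrightarrow> ?F s \<and> tarr s = tarr s0 \<and> barr s = barr s0 \<and> wreg s ! r_j = st + i \<and>
    wreg s ! r_rank = card {q \<in> below. q < i} \<and> wreg s ! r_ptr = length (codes (take i ?L)) \<and>
    (i \<le> pos \<longrightarrow> min (wreg s ! r_left) (Suc (?L ! i)) = left_max i \<and> wreg s ! r_right = 0) \<and>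
    (pos < i \<longrightarrow> wreg s ! r_pos = st + pos \<and> wreg s ! r_a = left_max pos \<and> 0 < wreg s ! r_right \<and>
      (i < length U \<longrightarrow> min (wreg s ! r_right) (Suc (?L ! i)) = Suc (lcp (suf pos) (suf i)))) \<and>
    wreg s ! r_b = right_max i" for i s
  have "wp w scan s0 (\<lambda>t s. t \<le> length U * Suc 15 + 1 \<and> I (length U) s)"
    unfolding scan_def
  proof (rule wp_While)
    show "I 0 s0"
      using regs pos by (simp add: I_def frame_def left_max_0 right_max_le_pos)
  next
    fix i s assume "i < length U" "I i s"
    then show "test_val (WTest LT r_j r_len) s = Some True"
      using len regs n by (simp add: I_def frame_def)
  next
    fix s assume "I (length U) s"
    then show "test_val (WTest LT r_j r_len) s = Some False"
      using len regs n by (simp add: I_def frame_def)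
  next
    fix i s assume i: "i < length U" and I: "I i s"
    have F: "?F s" and tb [simp]: "tarr s = tarr s0" "barr s = barr s0"
      and j [simp]: "wreg s ! r_j = st + i" and rk [simp]: "wreg s ! r_rank = card {q \<in> below. q < i}"
      and ptr [simp]: "wreg s ! r_ptr = length (codes (take i ?L))"
      and b [simp]: "wreg s ! r_b = right_max i"
      and before: "i \<le> pos \<Longrightarrow> min (wreg s ! r_left) (Suc (?L ! i)) = left_max i \<and> wreg s ! r_right = 0"
      and after: "pos < i \<Longrightarrow> wreg s ! r_pos = st + pos \<and> wreg s ! r_a = left_max pos \<and>
        0 < wreg s ! r_right \<and> min (wreg s ! r_right) (Suc (?L ! i)) = Suc (lcp (suf pos) (suf i))"
      using I i by (simp_all add: I_def)
    have l [simp]: "length (wreg s) = regs" "length (sreg s) = regs"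
      and [simp]: "wreg s ! r_len = n" "wreg s ! r_one = 1" "wreg s ! r_zero = 0"
        "sreg s ! s_new = c" "sreg s ! s_end = d"
      using F len regs by (simp_all add: frame_def)
    have [simp]: "wreg s \<noteq> []" using l(1) by (metis list.size(3) zero_neq_numeral)
    have sym [simp]: "tarr s0 ! (st + i) = B i"
      using tarr i n nth_drop[of st "tarr s0" i] by (simp add: B_def)
    have e: "Suc (?L ! i) < 2 ^ w" using lcp_array_less[OF i] n by simp
    have dr: "drop (length (codes (take i ?L))) (barr s0)
        = elias_delta (Suc (?L ! i)) @ codes (drop (Suc i) ?L) @ junk"
      using codes_nth[of i ?L] i by (simp add: barr compressed_lcp_codes)
    have p: "length (codes (take i ?L)) + length (elias_delta (Suc (?L ! i)))
        = length (codes (take (Suc i) ?L))"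
      using i by (simp add: length_codes_take_Suc)
    have p': "length (codes (take (Suc i) ?L)) < 2 ^ w"
      using length_codes_take[of "Suc i" ?L] barr by (simp add: compressed_lcp_codes)
    have dec: "wp w (Instr (Decode r_code r_ptr)) s Q = Q 1 (s\<lparr>wreg := (wreg s)
        [r_code := Suc (?L ! i), r_ptr := length (codes (take (Suc i) ?L))]\<rparr>)" for Q
      by (subst wp_Decode[OF _ _ _ e]) (use dr p p' in simp_all)
    have "card {q \<in> below. q < i} \<le> i"
      using card_mono[of "{..<i}" "{q \<in> below. q < i}"] by auto
    then have add: "binop_val w Add (card {q \<in> below. q < i}) (Suc 0) = Suc (card {q \<in> below. q < i})"
      "binop_val w Add (st + i) (Suc 0) = Suc (st + i)"
      using n i by simp_all
    have card_Suc: "card {q \<in> below. q < Suc i} = (if i \<in> below then Suc (card {q \<in> below. q < i})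
        else card {q \<in> below. q < i})"
    proof -
      have "{q \<in> below. q < Suc i} = (if i \<in> below then insert i {q \<in> below. q < i} else {q \<in> below. q < i})"
        by (auto simp: less_Suc_eq)
      then show ?thesis by (simp add: below_def)
    qed
    \<comment> \<open>The length of the text is thus large enough to act as infinity.\<close>
    have n_ge: "i < length U \<Longrightarrow> Suc (?L ! i) \<le> n" for i using lcp_array_less[of i] n by simp
    note Fs = F[unfolded frame_def]
    \<comment> \<open>Occurrences of \<open>c\<close> are told apart by their side of the sentinel:
      before it they count for \<open>rank\<close> and restart \<open>r_left\<close>, behind it they
      are candidates for \<open>r_b\<close>.\<close>
    consider "pos = i" | "i < pos" "B i \<noteq> c" | "i < pos" "B i = c" | "pos < i" "B i \<noteq> c"
      | "pos < i" "B i = c" by linarith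
    then show "wp w scan_body s (\<lambda>t s'. t \<le> 15 \<and> I (Suc i) s')"
    proof cases
      case 1
      have B_i: "i \<in> below" "B i = d" using 1 i c B_pos by (auto simp: below_def)
      then show ?thesis
        unfolding scan_body_def block.simps wp_Seq dec using tarr n i
        apply (simp add: add)
        using 1 before n p' n_ge[of "Suc i"] Fs
        by (simp add: I_def frame_def card_Suc lcp_array_nth[of "Suc i"] right_max_le_pos)
    next
      case 2
      then have B_i: "B i \<noteq> d" "i \<in> below \<and> B i < c \<or> i \<notin> below \<and> c < B i \<and> \<not> B i < c"
        using i B_neq[of i] by (auto simp: below_def)
      have 3: "i \<le> pos" "\<not> pos < i" "Suc i \<le> pos" "\<not> pos < Suc i" "Suc i < length U"
        using 2 pos by auto
      from B_i(2) show ?thesis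
        unfolding scan_body_def block.simps wp_Seq dec using tarr n i B_i(1) 2 before
        apply (elim disjE conjE)
        apply (simp_all add: add)
        using 3 n p' Fs
        by (simp_all add: I_def frame_def card_Suc left_max_Suc right_max_le_pos)
    next
      case 3
      then have B_i: "i \<in> below" "B i = c" "c \<noteq> d"
        using i B_neq[of i] by (auto simp: below_def)
      have 4: "i \<le> pos" "\<not> pos < i" "Suc i \<le> pos" "\<not> pos < Suc i" "Suc i < length U"
        using 3 pos by auto
      show ?thesis
        unfolding scan_body_def block.simps wp_Seq dec using tarr n i B_i before 3
        apply (simp add: add)
        using 4 n p' n_ge[of "Suc i"] Fs
        by (simp add: I_def frame_def card_Suc left_max_Suc right_max_le_pos)
    next
      case 4
      then have B_i: "B i \<noteq> d" "i \<in> below \<and> B i < c \<or> i \<notin> below \<and> c < B i \<and> \<not> B i < c"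
        using i B_neq[of i] by (auto simp: below_def)
      have 5: "\<not> i \<le> pos" "pos < i" "pos \<le> i" "\<not> Suc i \<le> pos" "pos < Suc i" using 4 by auto
      from B_i(2) show ?thesis
        unfolding scan_body_def block.simps wp_Seq dec using tarr n i B_i(1) 4
        apply (elim disjE conjE)
        apply (simp_all add: add)
        using 5 n p' Fs after
        by (simp_all add: I_def frame_def card_Suc right_max_Suc lcp_suf_step)
    next
      case 5
      then have B_i: "i \<notin> below" "B i = c" "c \<noteq> d"
        using i B_neq[of i] by (auto simp: below_def)
      have 6: "\<not> i \<le> pos" "pos < i" "pos \<le> i" "\<not> Suc i \<le> pos" "pos < Suc i" using 5 by auto
      show ?thesis
        unfolding scan_body_def block.simps wp_Seq dec using tarr n i B_i after[OF 6(2)]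
        apply (simp add: add)
        using 6 n p' Fs
        by (simp add: I_def frame_def card_Suc right_max_Suc lcp_suf_step)
    qed
  qed
  moreover have "{q \<in> below. q < length U} = below" by (auto simp: below_def)
  ultimately show ?thesis
    by (elim wp_mono) (simp add: I_def pos left_lcp_eq right_lcp_eq rank_def compressed_lcp_codes)
qed

end

section \<open>Moving symbols and bits\<close>

definition open_gap_body :: prog where
  "open_gap_body = block [
     Instr (LoadSym s_cur r_j),
     Instr (StoreSym r_dest s_cur),
     Instr (Decode r_code r_ptr),
     Instr (Move r_dest r_j),
     Instr (Arith Add r_j r_j r_one)]"

definition open_gap :: prog where
  "open_gap = While (WTest LT r_j r_tmp) open_gap_body"

text \<open>Going from left to right, each symbol moves into the cell just vacated, the first being
  \<open>st\<close>. The decoded values are discarded: decoding only carries \<open>r_ptr\<close>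
  behind the first \<open>r\<close> codes.\<close>

lemma wp_open_gap:
  fixes s0 :: "'a::linorder state"
  assumes len: "length (wreg s0) = regs" "length (sreg s0) = regs"
    and r: "r \<le> length L" "Suc st + length L < 2 ^ w" "Suc st + length L = length (tarr s0)"
    and regs: "wreg s0 ! r_one = 1" "wreg s0 ! r_j = Suc st" "wreg s0 ! r_tmp = Suc st + r"
      "wreg s0 ! r_dest = st" "wreg s0 ! r_ptr = 0"
    and L: "\<And>x. x \<in> set L \<Longrightarrow> Suc x < 2 ^ w"
    and barr: "barr s0 = codes L @ junk" "length (barr s0) < 2 ^ w"
  shows "wp w open_gap s0 (\<lambda>t s. t \<le> r * 6 + 1 \<and>
    frame {r_j, r_code, r_dest, r_ptr} {s_cur} s0 s \<and> barr s = barr s0 \<and>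
    tarr s = take st (tarr s0) @ take r (drop (Suc st) (tarr s0)) @ drop (st + r) (tarr s0) \<and>
    wreg s ! r_dest = st + r \<and> wreg s ! r_ptr = length (codes (take r L)))"
proof -
  let ?F = "frame {r_j, r_code, r_dest, r_ptr} {s_cur} s0"
  define I where "I i s \<longleftrightarrow> ?F s \<and> barr s = barr s0 \<and> wreg s ! r_j = Suc (st + i) \<and>
    tarr s = take st (tarr s0) @ take i (drop (Suc st) (tarr s0)) @ drop (st + i) (tarr s0) \<and>
    wreg s ! r_dest = st + i \<and> wreg s ! r_ptr = length (codes (take i L))" for i s
  have "wp w open_gap s0 (\<lambda>t s. t \<le> r * Suc 5 + 1 \<and> I r s)"
    unfolding open_gap_def
  proof (rule wp_While)
    show "I 0 s0"
      using regs by (simp add: I_def frame_def)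
  next
    fix i s assume "i < r" "I i s"
    then show "test_val (WTest LT r_j r_tmp) s = Some True"
      using len regs by (simp add: I_def frame_def)
  next
    fix s assume "I r s"
    then show "test_val (WTest LT r_j r_tmp) s = Some False"
      using len regs by (simp add: I_def frame_def)
  next
    fix i s assume i: "i < r" and I: "I i s"
    have F: "?F s" and [simp]: "barr s = barr s0" "wreg s ! r_j = Suc (st + i)"
        "wreg s ! r_dest = st + i" "wreg s ! r_ptr = length (codes (take i L))"
      and t [simp]: "tarr s = take st (tarr s0) @ take i (drop (Suc st) (tarr s0)) @ drop (st + i) (tarr s0)"
      using I by (simp_all add: I_def)
    have l [simp]: "length (wreg s) = regs" "length (sreg s) = regs" "wreg s ! r_one = 1"
      using F len regs by (simp_all add: frame_def)
    have iL: "i < length L" using i r by simp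
    have e: "Suc (L ! i) < 2 ^ w" using L iL by simp
    have dr: "drop (length (codes (take i L))) (barr s0)
        = elias_delta (Suc (L ! i)) @ codes (drop (Suc i) L) @ junk"
      using codes_nth[OF iL] by (simp add: barr)
    have p: "length (codes (take i L)) + length (elias_delta (Suc (L ! i)))
        = length (codes (take (Suc i) L))"
      using iL by (simp add: length_codes_take_Suc)
    have p': "length (codes (take (Suc i) L)) < 2 ^ w"
      using length_codes_take[of "Suc i" L] barr by simp
    have add: "binop_val w Add (Suc (st + i)) (Suc 0) = Suc (Suc (st + i))"
      using r i by simp
    have len_t: "length (tarr s) = length (tarr s0)" using r i by simp
    have nth: "tarr s ! Suc (st + i) = tarr s0 ! Suc (st + i)"
      using r i by (simp add: nth_append)
    have "drop (st + i) (tarr s0) = tarr s0 ! (st + i) # drop (Suc (st + i)) (tarr s0)"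
      using r i by (simp add: Cons_nth_drop_Suc)
    then have upd: "(tarr s)[st + i := tarr s0 ! Suc (st + i)] =
       take st (tarr s0) @ take (Suc i) (drop (Suc st) (tarr s0)) @ drop (Suc (st + i)) (tarr s0)"
      using r i by (simp add: list_update_append take_Suc_conv_app_nth)
    show "wp w open_gap_body s (\<lambda>t s'. t \<le> 5 \<and> I (Suc i) s')"
      unfolding open_gap_body_def block.simps wp_Seq using r i len_t
      apply (simp add: nth upd del: t)
      apply (subst wp_Decode[OF _ _ _ e])
      apply (simp_all add: dr)
      using F r p' by (simp add: p add I_def frame_def)
  qed
  then show ?thesis by (elim wp_mono) (simp add: I_def)
qed

section \<open>Moving a bit field to higher positions\<close>

definition shift_body :: prog where
  "shift_body = block [
       Instr (Arith Sub r_count r_count r_chunk),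
       Instr (Arith Add r_tmp r_ptr r_count),
       Instr (LoadBits r_code r_tmp r_chunk),
       Instr (Arith Add r_tmp r_tmp r_delta),
       Instr (StoreBits r_tmp r_chunk r_code)]"

definition shift_rest :: prog where
  "shift_rest = block [
       Instr (LoadBits r_code r_ptr r_count),
       Instr (Arith Add r_tmp r_ptr r_delta),
       Instr (StoreBits r_tmp r_count r_code)]"

definition shift_bits :: prog where
  "shift_bits = Seq (While (WTest LE r_chunk r_count) shift_body) shift_rest"

text \<open>Source and target may overlap, so chunks are moved from the rear: each is read before
  anything is written over it. The summand 4 pays for the failing test and the three instructions
  that move the remainder.\<close>

lemma wp_shift_bits:
  fixes s0 :: "'a::linorder state"
  assumes len: "length (wreg s0) = regs" "length (sreg s0) = regs"
    and regs: "wreg s0 ! r_ptr = p" "wreg s0 ! r_count = q" "wreg s0 ! r_chunk = m"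
      "wreg s0 ! r_delta = \<delta>"
    and m: "0 < m" "m \<le> w"
    and barr: "p + q + \<delta> \<le> length (barr s0)" "length (barr s0) < 2 ^ w"
  shows "wp w shift_bits s0 (\<lambda>t s. t \<le> q div m * 6 + 4 \<and>
    frame {r_count, r_tmp, r_code} {} s0 s \<and> tarr s = tarr s0 \<and>
    barr s = overwrite (barr s0) (p + \<delta>) (take q (drop p (barr s0))))"
proof -
  let ?F = "frame {r_count, r_tmp, r_code} {} s0"
  \<comment> \<open>The number of bits still to be moved after \<open>i\<close> passes.\<close>
  define x where "x i = q - i * m" for i
  define I where "I i s \<longleftrightarrow> ?F s \<and> tarr s = tarr s0 \<and> wreg s ! r_count = x i \<and>
    barr s = overwrite (barr s0) (p + x i + \<delta>) (take (q - x i) (drop (p + x i) (barr s0)))" for i s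
  have x_ge: "m \<le> x i" if "i < q div m" for i
  proof -
    have "Suc i * m \<le> q div m * m" using that by (intro mult_le_mono1) simp
    also have "\<dots> \<le> q" by simp
    finally show ?thesis by (simp add: x_def)
  qed
  have x_last: "x (q div m) < m"
    using m by (simp add: x_def minus_div_mult_eq_mod)
  have "x i \<le> q" for i by (simp add: x_def)
  have "wp w (While (WTest LE r_chunk r_count) shift_body) s0 (\<lambda>t s. t \<le> q div m * Suc 5 + 1 \<and> I (q div m) s)"
  proof (rule wp_While)
    show "I 0 s0"
      using regs barr by (simp add: I_def frame_def x_def overwrite_def)
  next
    fix i s assume "i < q div m" "I i s"
    then show "test_val (WTest LE r_chunk r_count) s = Some True"
      using len regs x_ge by (simp add: I_def frame_def)
  next
    fix s assume "I (q div m) s"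
    then show "test_val (WTest LE r_chunk r_count) s = Some False"
      using len regs x_last by (simp add: I_def frame_def)
  next
    fix i s assume i: "i < q div m" and I: "I i s"
    have F: "?F s" and [simp]: "tarr s = tarr s0" "wreg s ! r_count = x i"
      and b: "barr s = overwrite (barr s0) (p + x i + \<delta>) (take (q - x i) (drop (p + x i) (barr s0)))"
      using I by (simp_all add: I_def)
    have l [simp]: "length (wreg s) = regs" "length (sreg s) = regs" "wreg s ! r_ptr = p"
        "wreg s ! r_chunk = m" "wreg s ! r_delta = \<delta>"
      using F len regs by (simp_all add: frame_def)
    define y where "y = x (Suc i)"
    have xy: "x i = y + m" using x_ge[OF i] by (simp add: y_def x_def)
    have yq: "y + m \<le> q" using \<open>x i \<le> q\<close> xy by simp
    have lb: "length (barr s) = length (barr s0)" unfolding b using barr xy yq by simp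
    \<comment> \<open>All that has been written so far starts at or behind the end of this chunk,
      which is therefore still intact.\<close>
    have rd: "take m (drop (p + y) (barr s)) = take m (drop (p + y) (barr s0))"
      unfolding b xy using barr yq by (intro take_drop_overwrite) auto
    have ar: "binop_val w Sub (y + m) m = y" "binop_val w Add p y = p + y"
        "binop_val w Add (p + y) \<delta> = p + y + \<delta>"
      using barr yq by simp_all
    let ?v = "take m (drop (p + y) (barr s0))"
    have lv: "length ?v = m" using barr yq by simp
    have mb: "map (bit (horner_sum of_bool 2 ?v :: nat)) [0..<m] = ?v"
      using map_bit_horner_sum[of ?v] unfolding lv .
    have wr: "overwrite (barr s) (p + y + \<delta>) ?v
        = overwrite (barr s0) (p + y + \<delta>) (take (q - y) (drop (p + y) (barr s0)))"
    proof -
      have 1: "take (q - y) (drop (p + y) (barr s0))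
          = ?v @ take (q - (y + m)) (drop (p + (y + m)) (barr s0))"
        using yq take_add[of m "q - (y + m)" "drop (p + y) (barr s0)"]
        by (simp add: add.assoc add.commute add.left_commute)
      show ?thesis unfolding 1 b xy
        using overwrite_overwrite[of "p + y + \<delta>" ?v "take (q - (y + m)) (drop (p + (y + m)) (barr s0))" "barr s0"]
          barr yq lv by (simp add: add.assoc add.commute add.left_commute)
    qed
    show "wp w shift_body s (\<lambda>t s'. t \<le> 5 \<and> I (Suc i) s')"
      unfolding shift_body_def block.simps wp_Seq using m barr yq lb
      apply (simp add: xy ar rd mb wr)
      using F by (simp add: I_def frame_def flip: y_def)
  qed
  then show ?thesis
    unfolding shift_bits_def wp_Seq
  proof (rule wp_mono, elim conjE)
    fix t s assume t: "t \<le> q div m * Suc 5 + 1" and I: "I (q div m) s"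
    define y where "y = x (q div m)"
    have F: "?F s" and [simp]: "tarr s = tarr s0" "wreg s ! r_count = y"
      and b: "barr s = overwrite (barr s0) (p + y + \<delta>) (take (q - y) (drop (p + y) (barr s0)))"
      using I by (simp_all add: I_def y_def)
    have l [simp]: "length (wreg s) = regs" "length (sreg s) = regs" "wreg s ! r_ptr = p"
        "wreg s ! r_chunk = m" "wreg s ! r_delta = \<delta>"
      using F len regs by (simp_all add: frame_def)
    have y: "y < m" "y \<le> q" using x_last \<open>x (q div m) \<le> q\<close> by (simp_all add: y_def)
    have lb: "length (barr s) = length (barr s0)" unfolding b using barr y by simp
    have rd: "take y (drop p (barr s)) = take y (drop p (barr s0))"
      unfolding b using barr y by (intro take_drop_overwrite) auto
    let ?v = "take y (drop p (barr s0))"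
    have lv: "length ?v = y" using barr y by simp
    have mb: "map (bit (horner_sum of_bool 2 ?v :: nat)) [0..<y] = ?v"
      using map_bit_horner_sum[of ?v] unfolding lv .
    have wr: "overwrite (barr s) (p + \<delta>) ?v
        = overwrite (barr s0) (p + \<delta>) (take q (drop p (barr s0)))"
    proof -
      have 1: "take q (drop p (barr s0)) = ?v @ take (q - y) (drop (p + y) (barr s0))"
        using y take_add[of y "q - y" "drop p (barr s0)"] by (simp add: add.commute)
      show ?thesis unfolding 1 b
        using overwrite_overwrite[of "p + \<delta>" ?v "take (q - y) (drop (p + y) (barr s0))" "barr s0"]
          barr y lv by (simp add: add.assoc add.commute add.left_commute)
    qed
    have ar: "binop_val w Add p \<delta> = p + \<delta>" using barr by simp
    show "wp w shift_rest s (\<lambda>t' s'. t + t' \<le> q div m * 6 + 4 \<and>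
        ?F s' \<and> tarr s' = tarr s0 \<and>
        barr s' = overwrite (barr s0) (p + \<delta>) (take q (drop p (barr s0))))"
      using F m barr y lb len regs t
      by (simp add: shift_rest_def ar rd mb wr frame_def)
  qed
qed

section \<open>Inserting a suffix\<close>

lemma wp_SeqI:
  assumes "wp w P s (\<lambda>t s'. t \<le> a \<and> I s')"
    and "\<And>s'. I s' \<Longrightarrow> wp w R s' (\<lambda>t s''. t \<le> b \<and> J s'')"
  shows "wp w (Seq P R) s (\<lambda>t s''. t \<le> a + b \<and> J s'')"
  unfolding wp_Seq
proof (rule wp_mono[OF assms(1)], elim conjE)
  fix t s' assume "t \<le> a" "I s'"
  from wp_mono[OF assms(2)[OF this(2)]] \<open>t \<le> a\<close>
  show "wp w R s' (\<lambda>t' s''. t + t' \<le> a + b \<and> J s'')" by (simp add: add_mono)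
qed

lemma length_elias_delta_mono: "k \<le> l \<Longrightarrow> length (elias_delta k) \<le> length (elias_delta l)"
  using monoD[OF floor_log_mono, of k l]
  by (simp add: length_elias_delta add_mono monoD[OF floor_log_mono])

lemma length_elias_delta_pos: "0 < length (elias_delta l)"
  by (simp add: length_elias_delta)

section \<open>Code lengths and contents of the bit array after one insertion\<close>

context insertion
begin

definition new_code where "new_code = elias_delta (Suc (max left_lcp right_lcp))"

text \<open>The old entry at \<open>rank\<close> is the minimum of the two new ones, and
  \<open>new_code\<close> encodes their maximum.\<close>

lemma length_left_right:
  assumes "rank < length U"
  shows "length (elias_delta (Suc left_lcp)) + length (elias_delta (Suc right_lcp))
    = length new_code + length (elias_delta (Suc (lcp_array U ! rank)))"
  using assms by (auto simp: new_code_def lcp_array_rank max_def min_def)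

lemma codes_lcp_array_Cons:
  "codes (lcp_array (c # U)) = codes (take rank (lcp_array U)) @ elias_delta (Suc left_lcp) @
     (if rank < length U then elias_delta (Suc right_lcp) @ codes (drop (Suc rank) (lcp_array U)) else [])"
  by (simp add: lcp_array_Cons)

lemma right_lcp_0: "\<not> rank < length U \<Longrightarrow> right_lcp = 0"
  by (simp add: right_lcp_def)

text \<open>After a split one of the two new codes makes up for the old one. At the end of the
  array, \<open>right_lcp = 0\<close> makes \<open>new_code\<close> the code of the single new
  entry.\<close>

lemma length_compressed_lcp_Cons:
  "length (compressed_lcp (c # U)) = length (compressed_lcp U) + length new_code"
proof (cases "rank < length U")
  case True
  then show ?thesis
    using codes_nth[of rank "lcp_array U"] length_left_right
    by (simp add: compressed_lcp_codes codes_lcp_array_Cons)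
next
  case False
  then show ?thesis using rank_le
    by (simp add: compressed_lcp_codes codes_lcp_array_Cons right_lcp_0 new_code_def)
qed

text \<open>Codes are nonempty, so bit positions alone tell whether an old entry stands at
  \<open>rank\<close>; this is the test in \<open>write_codes\<close>.\<close>

lemma length_codes_take_rank:
  "length (codes (take rank (lcp_array U))) < length (compressed_lcp U) \<longleftrightarrow> rank < length U"
  using codes_nth[of rank "lcp_array U"] rank_le length_elias_delta_pos
  by (cases "rank < length U") (simp_all add: compressed_lcp_codes)

lemma lcp_array_Cons_length_elias:
  assumes "x \<in> set (lcp_array (c # U))"
  shows "x \<in> set (lcp_array U) \<or> length (elias_delta (Suc x)) \<le> length new_code"
proof -
  have "x \<in> set (lcp_array U) \<or> x = left_lcp \<or> x = right_lcp"
    using assms by (auto simp: lcp_array_Cons dest: in_set_takeD in_set_dropD split: if_splits)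
  then show ?thesis by (auto simp: new_code_def intro!: length_elias_delta_mono)
qed

lemma max_lcp_le: "max left_lcp right_lcp \<le> length U"
  using lcp_le[of "suf (rank - 1)" "c # U"] lcp_le[of "c # U" "suf rank"]
  by (auto simp: left_lcp_def right_lcp_def suf_def)

text \<open>The appended \<open>new_code\<close> serves for measuring only and may be overwritten.
  The move opens a gap of its length; the two new codes fill precisely this gap and the obsolete
  code behind it.\<close>

lemma insert_codes:
  fixes junk
  defines "p \<equiv> length (codes (take rank (lcp_array U)))" and "q \<equiv> length (compressed_lcp U)"
    and "\<delta> \<equiv> length new_code" and "ca \<equiv> elias_delta (Suc left_lcp)" and "cb \<equiv> elias_delta (Suc right_lcp)"
  defines "bs1 \<equiv> overwrite (compressed_lcp U @ junk) q new_code"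
  defines "bs2 \<equiv> overwrite bs1 (p + \<delta>) (take (q - p) (drop p bs1))"
  assumes "\<delta> \<le> length junk"
  shows "(if p < q then overwrite (overwrite bs2 p ca) (p + length ca) cb else overwrite bs2 p ca)
    = compressed_lcp (c # U) @ drop \<delta> junk"
proof -
  define P Q where "P = codes (take rank (lcp_array U))" and "Q = codes (drop rank (lcp_array U))"
  have PQ: "compressed_lcp U = P @ Q"
    by (simp add: compressed_lcp_codes P_def Q_def codes_take_drop)
  have p: "p = length P" and q: "q = length P + length Q" by (simp_all add: p_def q_def PQ flip: P_def)
  have bs1: "bs1 = P @ Q @ new_code @ drop \<delta> junk"
    using assms(7) by (simp add: bs1_def q PQ overwrite_def \<delta>_def)
  \<comment> \<open>The outdated bits that the move leaves in the gap.\<close>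
  define X where "X = take \<delta> (Q @ new_code)"
  have X: "length X = \<delta>" by (simp add: X_def \<delta>_def)
  have "drop (\<delta> + length Q) (Q @ new_code @ drop \<delta> junk) = drop \<delta> junk"
    by (simp add: \<delta>_def)
  moreover have "take \<delta> (Q @ new_code @ drop \<delta> junk) = X"
    by (simp add: X_def \<delta>_def)
  ultimately have bs2: "bs2 = P @ X @ Q @ drop \<delta> junk"
    unfolding bs2_def bs1 p q by (simp add: overwrite_def)
  show ?thesis
  proof (cases "rank < length U")
    case True
    then have pq: "p < q" using length_codes_take_rank by (simp add: p_def q_def)
    have Q: "Q = elias_delta (Suc (lcp_array U ! rank)) @ codes (drop (Suc rank) (lcp_array U))"
      using True by (simp add: Q_def Cons_nth_drop_Suc[symmetric])
    have l: "length ca + length cb = length X + length (elias_delta (Suc (lcp_array U ! rank)))"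
      using length_left_right[OF True] by (simp add: ca_def cb_def X \<delta>_def)
    have *: "overwrite (xs @ ys) (length xs) zs = xs @ zs @ drop (length zs) ys" for xs ys zs :: "bool list"
      by (simp add: overwrite_def)
    have "overwrite (overwrite bs2 p ca) (p + length ca) cb
       = P @ ca @ cb @ drop (length ca + length cb) (X @ Q @ drop \<delta> junk)"
      using *[of "P @ ca" "drop (length ca) (X @ Q @ drop \<delta> junk)" cb]
      unfolding bs2 p * drop_drop length_append append_assoc by (simp only: add.commute)
    also have "\<dots> = P @ ca @ cb @ codes (drop (Suc rank) (lcp_array U)) @ drop \<delta> junk"
      unfolding l Q by simp
    finally show ?thesis
      using pq True by (simp add: compressed_lcp_codes codes_lcp_array_Cons P_def ca_def cb_def)
  next
    case False
    then have "\<not> p < q" using length_codes_take_rank by (simp add: p_def q_def)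
    moreover have "Q = []" using False by (simp add: Q_def)
    moreover have "length ca = length X" using False X
      by (simp add: ca_def \<delta>_def new_code_def right_lcp_0)
    ultimately show ?thesis
      using False unfolding bs2 p
      by (simp add: overwrite_def compressed_lcp_codes codes_lcp_array_Cons P_def ca_def)
  qed
qed

end

section \<open>The program for one insertion and its correctness\<close>

definition start_scan :: prog where
  "start_scan = block [
     Instr (Arith Sub r_next r_start r_one),
     Instr (LoadSym s_new r_next),
     Instr (Move r_j r_start),
     Instr (Move r_left r_zero),
     Instr (Move r_right r_zero),
     Instr (Move r_rank r_zero),
     Instr (Move r_b r_zero),
     Instr (Move r_ptr r_zero)]"

text \<open>\<open>r_dest\<close> starts at the cell of \<open>c\<close>, which is free once
  \<open>c\<close> stands in place of the sentinel.\<close>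

definition replace_sentinel :: prog where
  "replace_sentinel = block [
     Instr (Move r_end r_ptr),
     Instr (StoreSym r_pos s_new),
     Instr (Move r_j r_start),
     Instr (Move r_ptr r_zero),
     Instr (Arith Add r_tmp r_start r_rank),
     Instr (Move r_dest r_next)]"

text \<open>The length of a code is measured by writing it behind the used part of the bit array.\<close>

definition append_code :: prog where
  "append_code = block [
     Instr (StoreSym r_dest s_end),
     Instr (Arith Add r_a r_a r_one),
     Instr (Arith Add r_b r_b r_one),
     Instr (Move r_code r_a),
     max_into r_code r_b,
     Instr (Move r_tmp r_end),
     Instr (Encode r_tmp r_code),
     Instr (Arith Sub r_delta r_tmp r_end),
     max_into r_chunk r_delta,
     Instr (Arith Sub r_count r_end r_ptr)]"

definition write_codes :: prog where
  "write_codes = block [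
     Cond (WTest LT r_ptr r_end)
       (block [Instr (Encode r_ptr r_a), Instr (Encode r_ptr r_b)])
       (Instr (Encode r_ptr r_a)),
     Instr (Move r_start r_next)]"

definition insert_suffix :: prog where
  "insert_suffix = Seq start_scan (Seq scan (Seq replace_sentinel (Seq open_gap
     (Seq append_code (Seq shift_bits write_codes)))))"

text \<open>The invariant between insertions. \<open>r_chunk\<close> fits a word, as moving by
  chunks requires, and bounds the length of every stored code, on which the linear time rests. The
  bits behind the codes are arbitrary.\<close>

definition ready :: "nat \<Rightarrow> 'a::linorder \<Rightarrow> 'a list \<Rightarrow> nat \<Rightarrow> nat \<Rightarrow> 'a state \<Rightarrow> bool" where
  "ready w d T N st s \<longleftrightarrow>
     length (wreg s) = regs \<and> length (sreg s) = regs \<and>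
     wreg s ! r_len = length T \<and> wreg s ! r_one = 1 \<and> wreg s ! r_zero = 0 \<and> wreg s ! r_start = st \<and>
     sreg s ! s_end = d \<and> tarr s = take st T @ bwt d (drop st T) \<and>
     length (barr s) = N \<and> (\<exists>junk. barr s = compressed_lcp (drop st T) @ junk) \<and>
     0 < wreg s ! r_chunk \<and> wreg s ! r_chunk \<le> w \<and>
     (\<forall>x \<in> set (lcp_array (drop st T)). length (elias_delta (Suc x)) \<le> wreg s ! r_chunk)"

text \<open>Scanning, moving symbols and moving bits are linear in the number of entries, with
  factors 16, 6 and 6; the rest takes constant time.\<close>

lemma wp_insert_suffix:
  fixes s0 :: "'a::linorder state"
  assumes ins: "insertion d (T ! st) (drop (Suc st) T)" and st: "Suc st < length T"
    and ready: "ready w d T N (Suc st) s0"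
    and N: "length (compressed_lcp (drop st T)) \<le> N" "N < 2 ^ w"
    and w: "length T < 2 ^ w" "length (elias_delta (length T)) \<le> w"
  shows "wp w insert_suffix s0 (\<lambda>t s. t \<le> 28 * length T + 50 \<and> ready w d T N st s)"
proof -
  define c U pre where "c = T ! st" and "U = drop (Suc st) T" and "pre = take st T"
  interpret insertion d c U using ins by (simp add: c_def U_def)
  have cU: "drop st T = c # U" using st by (simp add: c_def U_def Cons_nth_drop_Suc)
  have T: "take (Suc st) T = pre @ [c]"
    using st by (simp add: pre_def c_def take_Suc_conv_app_nth)
  have pre: "length pre = st" using st by (simp add: pre_def)
  have n: "length T = Suc st + length U" using st by (simp add: U_def)
  define m where "m = wreg s0 ! r_chunk"
  have s0: "length (wreg s0) = regs" "length (sreg s0) = regs"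
     "wreg s0 ! r_len = length T" "wreg s0 ! r_one = 1" "wreg s0 ! r_zero = 0" "wreg s0 ! r_start = Suc st"
     "sreg s0 ! s_end = d" "length (barr s0) = N"
    and m: "0 < m" "m \<le> w" "\<And>x. x \<in> set (lcp_array U) \<Longrightarrow> length (elias_delta (Suc x)) \<le> m"
    and t0: "tarr s0 = pre @ c # bwt d U"
    using ready by (simp_all add: ready_def m_def T flip: U_def)
  obtain junk where junk: "barr s0 = compressed_lcp U @ junk"
    using ready by (auto simp: ready_def simp flip: U_def)
  define p q \<delta> where "p = length (codes (take rank (lcp_array U)))" and "q = length (compressed_lcp U)"
    and "\<delta> = length new_code"
  \<comment> \<open>The code appended for measuring fits because the new compressed array is longer
    by exactly its length.\<close>
  have qN: "q + \<delta> \<le> N" using N(1) unfolding cU length_compressed_lcp_Cons q_def \<delta>_def by simp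
  have pq: "p \<le> q" by (simp add: p_def q_def compressed_lcp_codes length_codes_take)
  have \<delta>w: "\<delta> \<le> w"
  proof -
    have "\<delta> \<le> length (elias_delta (length T))"
      unfolding \<delta>_def new_code_def using max_lcp_le n by (intro length_elias_delta_mono) simp
    with w show ?thesis by simp
  qed
  define m' where "m' = max m \<delta>"
  have m': "0 < m'" "m' \<le> w" using m \<delta>w by (simp_all add: m'_def)
  \<comment> \<open>What stays fixed between \<open>start_scan\<close> and
    \<open>write_codes\<close>, except for the chunk length \<open>k\<close>. \<open>P1\<close> to
    \<open>P6\<close> add the state after each part.\<close>
  define env where "env k s \<longleftrightarrow> length (wreg s) = regs \<and> length (sreg s) = regs \<and>
     wreg s ! r_len = length T \<and> wreg s ! r_one = 1 \<and> wreg s ! r_zero = 0 \<and> wreg s ! r_start = Suc st \<and>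
     wreg s ! r_next = st \<and> wreg s ! r_chunk = k \<and>
     sreg s ! s_end = d \<and> sreg s ! s_new = c" for k and s :: "'a state"
  define P1 where "P1 s \<longleftrightarrow> env m s \<and> wreg s ! r_j = Suc st \<and> wreg s ! r_left = 0 \<and> wreg s ! r_right = 0 \<and>
     wreg s ! r_rank = 0 \<and> wreg s ! r_b = 0 \<and> wreg s ! r_ptr = 0 \<and> tarr s = tarr s0 \<and> barr s = barr s0" for s
  define P2 where "P2 s \<longleftrightarrow> env m s \<and> wreg s ! r_rank = rank \<and> wreg s ! r_pos = Suc st + pos \<and>
     wreg s ! r_a = left_lcp \<and> wreg s ! r_b = right_lcp \<and> wreg s ! r_ptr = q \<and>
     tarr s = tarr s0 \<and> barr s = barr s0" for s
  define B' where "B' = (bwt d U)[pos := c]"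
  define P3 where "P3 s \<longleftrightarrow> env m s \<and> wreg s ! r_end = q \<and> wreg s ! r_j = Suc st \<and> wreg s ! r_ptr = 0 \<and>
     wreg s ! r_tmp = Suc st + rank \<and> wreg s ! r_dest = st \<and>
     wreg s ! r_a = left_lcp \<and> wreg s ! r_b = right_lcp \<and>
     tarr s = pre @ c # B' \<and> barr s = barr s0" for s
  define P4 where "P4 s \<longleftrightarrow> env m s \<and> wreg s ! r_end = q \<and> wreg s ! r_ptr = p \<and>
     wreg s ! r_dest = st + rank \<and> wreg s ! r_a = left_lcp \<and> wreg s ! r_b = right_lcp \<and>
     tarr s = pre @ take rank B' @ drop rank (c # B') \<and> barr s = barr s0" for s
  define bs1 where "bs1 = overwrite (barr s0) q new_code"
  define bs2 where "bs2 = overwrite bs1 (p + \<delta>) (take (q - p) (drop p bs1))"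
  define P5 where "P5 s \<longleftrightarrow> env m' s \<and> wreg s ! r_end = q \<and> wreg s ! r_ptr = p \<and>
     wreg s ! r_a = Suc left_lcp \<and> wreg s ! r_b = Suc right_lcp \<and> wreg s ! r_delta = \<delta> \<and>
     wreg s ! r_count = q - p \<and> tarr s = pre @ bwt d (c # U) \<and> barr s = bs1" for s
  define P6 where "P6 s \<longleftrightarrow> env m' s \<and> wreg s ! r_end = q \<and> wreg s ! r_ptr = p \<and>
     wreg s ! r_a = Suc left_lcp \<and> wreg s ! r_b = Suc right_lcp \<and>
     tarr s = pre @ bwt d (c # U) \<and> barr s = bs2" for s
  have U2: "length U < 2 ^ w" using n w by simp
  have lt: "left_lcp < 2 ^ w" "right_lcp < 2 ^ w" "Suc left_lcp < 2 ^ w" "Suc right_lcp < 2 ^ w"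
    using max_lcp_le n w by auto
  have 1: "wp w start_scan s0 (\<lambda>t s. t \<le> 8 \<and> P1 s)"
  proof -
    have "binop_val w Sub (Suc st) (Suc 0) = st" using n w by simp
    then show ?thesis
      using s0 t0 pre by (simp add: start_scan_def P1_def env_def m_def nth_append)
  qed
  have 2: "wp w scan s (\<lambda>t s. t \<le> 16 * length U + 1 \<and> P2 s)" if "P1 s" for s
  proof -
    have "wp w scan s (\<lambda>t s'. t \<le> length U * 16 + 1 \<and>
      frame {r_j, r_code, r_left, r_right, r_rank, r_pos, r_a, r_b, r_ptr} {s_cur} s s' \<and>
      tarr s' = tarr s \<and> barr s' = barr s \<and> wreg s' ! r_rank = rank \<and> wreg s' ! r_pos = Suc st + pos \<and>
      wreg s' ! r_a = left_lcp \<and> wreg s' ! r_b = right_lcp \<and>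
      wreg s' ! r_ptr = length (compressed_lcp U))"
      using that n w N s0 by (intro wp_scan[where n = "length T" and junk = junk])
        (simp_all add: P1_def env_def t0 pre junk)
    then show ?thesis
      by (rule wp_mono) (use that in \<open>simp add: P1_def P2_def env_def frame_def q_def\<close>)
  qed
  have 3: "wp w replace_sentinel s (\<lambda>t s. t \<le> 6 \<and> P3 s)" if "P2 s" for s
  proof -
    have "binop_val w Add (Suc st) rank = Suc st + rank" using n w rank_le by simp
    moreover have "(pre @ c # bwt d U)[Suc (st + pos) := c] = pre @ c # B'"
      using pos by (simp add: list_update_append pre B'_def)
    ultimately show ?thesis
      using that pos by (simp add: replace_sentinel_def P2_def P3_def env_def t0 pre)
  qed
  have 4: "wp w open_gap s (\<lambda>t s. t \<le> 6 * length U + 1 \<and> P4 s)" if "P3 s" for s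
  proof -
    have "wp w open_gap s (\<lambda>t s'. t \<le> rank * 6 + 1 \<and>
      frame {r_j, r_code, r_dest, r_ptr} {s_cur} s s' \<and> barr s' = barr s \<and>
      tarr s' = take st (tarr s) @ take rank (drop (Suc st) (tarr s)) @ drop (st + rank) (tarr s) \<and>
      wreg s' ! r_dest = st + rank \<and> wreg s' ! r_ptr = length (codes (take rank (lcp_array U))))"
      using that n w N s0 rank_le lcp_array_less
      by (intro wp_open_gap[where junk = junk])
        (auto simp: P3_def env_def pre junk compressed_lcp_codes B'_def in_set_conv_nth
          intro: le_less_trans[OF _ U2] Suc_leI)
    then show ?thesis
      by (rule wp_mono) (use that rank_le in \<open>simp add: P3_def P4_def env_def frame_def p_def pre\<close>)
  qed
  have 5: "wp w append_code s (\<lambda>t s. t \<le> 12 \<and> P5 s)" if "P4 s" for s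
  proof -
    have a: "binop_val w Add left_lcp (Suc 0) = Suc left_lcp"
      "binop_val w Add right_lcp (Suc 0) = Suc right_lcp" "binop_val w Sub q p = q - p"
      "binop_val w Sub (q + \<delta>) q = \<delta>"
      using lt pq qN N by simp_all
    have c: "elias_delta (Suc (max left_lcp right_lcp)) = new_code" "length new_code = \<delta>"
      by (simp_all add: new_code_def \<delta>_def)
    have e: "wreg s ! r_end = q" "wreg s ! r_ptr = p" "wreg s ! r_dest = st + rank"
      "wreg s ! r_a = left_lcp" "wreg s ! r_b = right_lcp" "barr s = barr s0"
      "length (wreg s) = regs" "length (sreg s) = regs" "wreg s ! r_one = 1" "sreg s ! s_end = d"
      "wreg s ! r_chunk = m"
      and env: "env m s" and t: "tarr s = pre @ take rank B' @ drop rank (c # B')"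
      using that by (simp_all add: P4_def env_def)
    \<comment> \<open>Opening the gap leaves an outdated symbol in cell \<open>st + rank\<close>;
      the new sentinel goes there.\<close>
    have "(tarr s)[st + rank := d] = pre @ take rank B' @ d # drop rank B'"
      using rank_le by (simp add: t list_update_append pre B'_def Cons_nth_drop_Suc[symmetric] min_def)
    then have u: "(tarr s)[st + rank := d] = pre @ bwt d (c # U)"
      by (simp add: bwt_Cons B'_def)
    have len: "st + rank < length (tarr s)"
      using rank_le by (simp add: t pre B'_def)
    show ?thesis
      using qN N(2) s0(8) len
      apply (simp add: append_code_def e a u c)
      using env by (simp add: P5_def env_def e a c m'_def bs1_def)
  qed
  have lb1: "length bs1 = N" using s0 qN by (simp add: bs1_def \<delta>_def)
  have 6: "wp w shift_bits s (\<lambda>t s. t \<le> 6 * length U + 4 \<and> P6 s)" if "P5 s" for s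
  proof -
    \<comment> \<open>No code is longer than \<open>m'\<close>, so there are at most as many chunks
      as entries.\<close>
    have "q \<le> length U * m'"
      using length_codes_le[of "lcp_array U" m'] m(3)
      by (force simp: q_def compressed_lcp_codes m'_def)
    then have "(q - p) div m' \<le> length U * m' div m'" by (intro div_le_mono) simp
    then have d: "(q - p) div m' \<le> length U" using m' by simp
    have "wp w shift_bits s (\<lambda>t s'. t \<le> (q - p) div m' * 6 + 4 \<and>
      frame {r_count, r_tmp, r_code} {} s s' \<and> tarr s' = tarr s \<and>
      barr s' = overwrite (barr s) (p + \<delta>) (take (q - p) (drop p (barr s))))"
      using that m' qN pq N lb1 by (intro wp_shift_bits) (simp_all add: P5_def env_def)
    then show ?thesis
    proof (rule wp_mono, elim conjE)
      fix t s'
      assume "t \<le> (q - p) div m' * 6 + 4"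
      then have "t \<le> 6 * length U + 4" using d by linarith
      moreover assume "frame {r_count, r_tmp, r_code} {} s s'" "tarr s' = tarr s"
        "barr s' = overwrite (barr s) (p + \<delta>) (take (q - p) (drop p (barr s)))"
      then have "P6 s'" using that by (simp add: P5_def P6_def env_def frame_def bs2_def)
      ultimately show "t \<le> 6 * length U + 4 \<and> P6 s'" ..
    qed
  qed
  have lb2: "length bs2 = N" using lb1 qN pq by (simp add: bs2_def)
  have res: "(if p < q then overwrite (overwrite bs2 p (elias_delta (Suc left_lcp)))
        (p + length (elias_delta (Suc left_lcp))) (elias_delta (Suc right_lcp))
      else overwrite bs2 p (elias_delta (Suc left_lcp))) = compressed_lcp (c # U) @ drop \<delta> junk"
    unfolding p_def q_def \<delta>_def bs2_def bs1_def junk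
    using qN s0(8) by (intro insert_codes) (simp add: \<delta>_def q_def junk)
  have 7: "wp w write_codes s (\<lambda>t s. t \<le> 4 \<and> ready w d T N st s)" if "P6 s" for s
  proof -
    have ready_I: "ready w d T N st s'"
      if "env m' (s'\<lparr>wreg := (wreg s')[r_start := Suc st]\<rparr>)" "wreg s' ! r_start = st"
       "tarr s' = pre @ bwt d (c # U)" "length (barr s') = N" "barr s' = compressed_lcp (c # U) @ drop \<delta> junk"
      for s'
    proof -
      have "length (elias_delta (Suc x)) \<le> m'" if "x \<in> set (lcp_array (c # U))" for x
        using lcp_array_Cons_length_elias[OF that] m(3) by (auto simp: m'_def \<delta>_def le_max_iff_disj)
      then show ?thesis
        using that m' by (simp add: ready_def env_def cU flip: pre_def)
    qed
    have l: "length (compressed_lcp (c # U)) = p + length (elias_delta (Suc left_lcp)) +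
       (if p < q then length (elias_delta (Suc right_lcp)) + length (codes (drop (Suc rank) (lcp_array U))) else 0)"
      using length_codes_take_rank
      by (simp add: compressed_lcp_codes codes_lcp_array_Cons p_def q_def)
    have lN: "length (compressed_lcp (c # U)) \<le> N" using N(1) by (simp add: cU)
    show ?thesis
    proof (cases "p < q")
      case True
      then have *: "overwrite (overwrite bs2 p (elias_delta (Suc left_lcp)))
        (p + length (elias_delta (Suc left_lcp))) (elias_delta (Suc right_lcp))
        = compressed_lcp (c # U) @ drop \<delta> junk" using res by simp
      have l': "p + length (elias_delta (Suc left_lcp)) + length (elias_delta (Suc right_lcp)) \<le> N"
        using True l lN by simp
      have "length (compressed_lcp (c # U) @ drop \<delta> junk) = N"
        unfolding *[symmetric] using l' lb2 by simp
      then show ?thesis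
        using that True l' N lb2
        apply (simp add: write_codes_def P6_def env_def *)
        apply (intro ready_I)
        apply (simp_all add: env_def)
        done
    next
      case False
      then have *: "overwrite bs2 p (elias_delta (Suc left_lcp)) = compressed_lcp (c # U) @ drop \<delta> junk"
        using res by simp
      have l': "p + length (elias_delta (Suc left_lcp)) \<le> N"
        using False l lN by simp
      have "length (compressed_lcp (c # U) @ drop \<delta> junk) = N"
        unfolding *[symmetric] using l' lb2 by simp
      then show ?thesis
        using that False l' N lb2
        apply (simp add: write_codes_def P6_def env_def *)
        apply (intro ready_I)
        apply (simp_all add: env_def)
        done
    qed
  qed
  have "wp w insert_suffix s0 (\<lambda>t s. t \<le> 8 + (16 * length U + 1 + (6 + (6 * length U + 1 + (12 +
      (6 * length U + 4 + 4))))) \<and> ready w d T N st s)"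
    unfolding insert_suffix_def by (intro wp_SeqI[OF 1] wp_SeqI[OF 2] wp_SeqI[OF 3] wp_SeqI[OF 4]
      wp_SeqI[OF 5] wp_SeqI[OF 6] 7)
  then show ?thesis by (rule wp_mono) (simp add: n)
qed

section \<open>Time and space\<close>

text \<open>Treats the suffix \<open>[d]\<close>: it is its own transform, and the code of its only
  entry \<open>0\<close> is one bit long, which becomes the first chunk length.\<close>

definition initialize :: prog where
  "initialize = block [
     Instr (Const r_one 1),
     Instr (Const r_zero 0),
     Instr (Arith Sub r_start r_len r_one),
     Instr (LoadSym s_end r_start),
     Instr (Move r_ptr r_zero),
     Instr (Encode r_ptr r_one),
     Instr (Move r_chunk r_ptr)]"

definition bwt_lcp :: prog where
  "bwt_lcp = Seq initialize (While (WTest LT r_zero r_start) insert_suffix)"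

section \<open>Bounds on all lengths that occur during the computation\<close>

lemma insertion_texts:
  assumes "\<forall>x\<in>\<Sigma>. d < x" "T \<in> texts d \<Sigma> n" "Suc k < n"
  shows "insertion d (T ! k) (drop (Suc k) T)"
proof -
  from assms obtain u where T: "T = u @ [d]" and u: "set u \<subseteq> \<Sigma>" "length u + 1 = n"
    by (auto simp: texts_def)
  have k: "k < length u" using assms u by simp
  then have "butlast (drop (Suc k) T) = drop (Suc k) u" by (simp add: T butlast_append)
  moreover have "T ! k \<in> set u" using k by (simp add: T nth_append)
  ultimately show ?thesis
    using assms(1) u k by unfold_locales (auto simp: T dest: in_set_dropD)
qed

text \<open>Each insertion lengthens the compressed array, so no intermediate result exceeds the bit
  array, whose length is that of the final one.\<close>

lemma length_compressed_lcp_drop: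
  assumes "\<forall>x\<in>\<Sigma>. d < x" "T \<in> texts d \<Sigma> n" "k < n"
  shows "length (compressed_lcp (drop k T)) \<le> length (compressed_lcp T)"
  using assms(3)
proof (induction k)
  case (Suc k)
  then interpret insertion d "T ! k" "drop (Suc k) T" using assms insertion_texts by blast
  have "length T = n" using assms(2) by (auto simp: texts_def)
  then have "drop k T = T ! k # drop (Suc k) T" using Suc.prems by (simp add: Cons_nth_drop_Suc)
  then show ?case using Suc length_compressed_lcp_Cons by simp
qed simp

text \<open>For \<open>k = floor_log l\<close>, the inequality \<open>k + 1 <= 2 ^ k\<close> bounds
  the nested logarithm by \<open>k\<close>. A bound linear in one logarithm suffices for both the
  word size and the average case.\<close>

lemma length_elias_delta_le: "length (elias_delta l) \<le> 3 * floor_log l + 1"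
proof -
  have "floor_log l + 1 \<le> 2 ^ floor_log l" by (metis Suc_eq_plus1 Suc_leI less_exp)
  then have "floor_log (floor_log l + 1) \<le> floor_log (2 ^ floor_log l)"
    by (rule floor_log_le_iff)
  then show ?thesis by (simp add: length_elias_delta)
qed

lemma floor_log_le_log:
  assumes "0 < l"
  shows "real (floor_log l) \<le> log 2 (real l)"
  using assms by (simp add: floor_log_altdef)

lemma lcp_array_le: "x \<in> set (lcp_array T) \<Longrightarrow> x \<le> length T"
proof -
  have "lcp (drop i T) y \<le> length T" for i y using lcp_le(1)[of "drop i T" y] by simp
  then show "x \<in> set (lcp_array T) \<Longrightarrow> x \<le> length T"
    by (auto simp: lcp_array_def split: if_splits)
qed

lemma length_compressed_lcp_le: "length (compressed_lcp T) \<le> length T * (3 * length T + 4)"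
proof -
  have "length (elias_delta (Suc x)) \<le> 3 * length T + 4" if "x \<in> set (lcp_array T)" for x
  proof -
    have "floor_log (Suc x) \<le> Suc x"
      using floor_log_exp2_le[of "Suc x"] less_exp[of "floor_log (Suc x)"] by linarith
    then show ?thesis
      using length_elias_delta_le[of "Suc x"] lcp_array_le[OF that] by linarith
  qed
  from length_codes_le[of "lcp_array T", OF this] show ?thesis by (simp add: compressed_lcp_codes)
qed

text \<open>The factor 6 yields \<open>n ^ 6 <= 2 ^ w\<close>, and \<open>n >= 2\<close> puts the
  quadratic bound on bit positions below \<open>2 ^ 4 * n ^ 2\<close>, hence below
  \<open>n ^ 6\<close>. The code length is at most \<open>3 * log 2 n + 1\<close>.\<close>

lemma word_size:
  assumes "2 \<le> n" "6 * log 2 (real n) \<le> real w"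
  shows "n * (3 * n + 4) < 2 ^ w" "n < 2 ^ w" "length (elias_delta n) \<le> w"
proof -
  have "real n ^ 6 = (2 powr log 2 (real n)) powr 6"
    using assms(1) by simp
  also have "\<dots> = 2 powr (6 * log 2 (real n))"
    by (simp only: powr_powr mult.commute)
  also have "\<dots> \<le> 2 powr real w" using assms(2) by simp
  finally have "real (n ^ 6) \<le> real (2 ^ w)" by (simp add: powr_realpow)
  then have w: "n ^ 6 \<le> 2 ^ w" by (simp only: of_nat_le_iff)
  have "n * 4 \<le> n * (2 * n)" using assms(1) by simp
  then have "n * (3 * n + 4) \<le> 5 * (n * n)" by (simp add: algebra_simps)
  also have "\<dots> < 2 ^ 4 * (n * n)" using assms(1) by simp
  also have "\<dots> \<le> n ^ 4 * (n * n)" using assms(1) by (intro mult_right_mono power_mono) auto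
  also have "\<dots> = n ^ 6" by (simp add: eval_nat_numeral)
  finally show *: "n * (3 * n + 4) < 2 ^ w" using w by simp
  have "n \<le> n * (3 * n + 4)" by simp
  with * show "n < 2 ^ w" by (rule le_less_trans[rotated])
  have "real (floor_log n) \<le> log 2 (real n)" using assms(1) by (intro floor_log_le_log) simp
  moreover have "1 \<le> log 2 (real n)" using assms(1) by simp
  ultimately have "real (3 * floor_log n + 1) \<le> real w" using assms(2) by simp
  then have "3 * floor_log n + 1 \<le> w" by (simp only: of_nat_le_iff)
  then show "length (elias_delta n) \<le> w" using length_elias_delta_le[of n] by simp
qed

lemma wp_bwt_lcp:
  fixes d :: "'a::linorder"
  assumes d: "\<forall>x\<in>\<Sigma>. d < x" and T: "T \<in> texts d \<Sigma> n"
    and w: "6 * log 2 (real n) \<le> real w" and init: "initial w regs T s0"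
  shows "wp w bwt_lcp s0 (\<lambda>t s. t \<le> n * (28 * n + 51) + 8 \<and>
    tarr s = bwt d T \<and> barr s = compressed_lcp T)"
proof -
  define N where "N = length (compressed_lcp T)"
  from T obtain u where u: "T = u @ [d]" "u \<noteq> []" "length u + 1 = n" by (auto simp: texts_def)
  then have n: "2 \<le> n" "length T = n" by (auto simp: Suc_le_eq)
  note w' = word_size[OF n(1) w]
  have NW: "N < 2 ^ w" using length_compressed_lcp_le[of T] w'(1) by (simp add: N_def n)
  have lN: "length (compressed_lcp (drop k T)) \<le> N" if "k < n" for k
    using length_compressed_lcp_drop[OF d T that] by (simp add: N_def)
  have last: "drop (n - 1) T = [d]" using u by auto
  have sa: "suffix_array [d] = [0]" by (simp add: suffix_array_def)
  have base: "bwt d [d] = [d]" "lcp_array [d] = [0]"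
    by (simp_all add: bwt_def lcp_array_def sa)
  have len1: "length (elias_delta (Suc 0)) = 1" by (simp add: length_elias_delta)
  have N1: "1 \<le> N" using lN[of "n - 1"] n len1 unfolding last by (simp add: compressed_lcp_codes base)
  have w1: "1 < (2::nat) ^ w" using w'(2) n by linarith
  then have w0: "0 < w" by (cases w) auto
  have 1: "wp w initialize s0 (\<lambda>t s. t \<le> 7 \<and> ready w d T N (n - 1) s)"
  proof -
    have s0: "length (wreg s0) = regs" "length (sreg s0) = regs" "wreg s0 ! 0 = n" "tarr s0 = T"
      "length (barr s0) = N"
      using init by (simp_all add: initial_def N_def n)
    moreover from this have "wreg s0 \<noteq> []" by auto
    moreover have "binop_val w Sub n (Suc 0) = n - 1" using w' n by simp
    moreover have "T ! (n - 1) = d" using u by auto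
    moreover have "T = take (n - 1) T @ [d]" using u by auto
    ultimately show ?thesis
      using n N1 w1 w0 len1
      apply (simp add: initialize_def)
      apply (simp add: ready_def last[simplified] base compressed_lcp_codes overwrite_def)
      done
  qed
  \<comment> \<open>Pass \<open>i\<close> starts from the suffix at \<open>n - 1 - i\<close>, so
    \<open>n - 1\<close> insertions lead from \<open>[d]\<close> to the whole text.\<close>
  have 2: "wp w (While (WTest LT r_zero r_start) insert_suffix) s
    (\<lambda>t s. t \<le> (n - 1) * Suc (28 * n + 50) + 1 \<and> ready w d T N (n - 1 - (n - 1)) s)"
    if "ready w d T N (n - 1) s" for s
  proof (rule wp_While[where I = "\<lambda>i. ready w d T N (n - 1 - i)"])
    show "ready w d T N (n - 1 - 0) s" using that by simp
  next
    fix i s assume "i < n - 1" "ready w d T N (n - 1 - i) s"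
    then show "test_val (WTest LT r_zero r_start) s = Some True"
      by (simp add: ready_def)
  next
    fix s assume "ready w d T N (n - 1 - (n - 1)) s"
    then show "test_val (WTest LT r_zero r_start) s = Some False"
      by (simp add: ready_def)
  next
    fix i s assume i: "i < n - 1" and r: "ready w d T N (n - 1 - i) s"
    define k where "k = n - 1 - Suc i"
    have k: "n - 1 - i = Suc k" "Suc k < n \<or> Suc k = n - 1" "k < n" "Suc k < length T"
      using i n by (auto simp: k_def)
    show "wp w insert_suffix s (\<lambda>t s'. t \<le> 28 * n + 50 \<and> ready w d T N (n - 1 - Suc i) s')"
      unfolding k_def[symmetric]
      using wp_insert_suffix[OF insertion_texts[OF d T] _ _ lN NW, of k s] w' k r n
      by (simp cong del: wp_weak_cong)
  qed
  show ?thesis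
    unfolding bwt_lcp_def
  proof (rule wp_mono[OF wp_SeqI[OF 1 2]], assumption, elim conjE)
    fix t s assume t: "t \<le> 7 + ((n - 1) * Suc (28 * n + 50) + 1)" and r: "ready w d T N (n - 1 - (n - 1)) s"
    have "(n - 1) * Suc (28 * n + 50) \<le> n * (28 * n + 51)" by (intro mult_le_mono) auto
    then have "t \<le> n * (28 * n + 51) + 8" using t by linarith
    moreover have "tarr s = bwt d T" "barr s = compressed_lcp T"
      using r by (auto simp: ready_def N_def)
    ultimately show "t \<le> n * (28 * n + 51) + 8 \<and> tarr s = bwt d T \<and> barr s = compressed_lcp T"
      by simp
  qed
qed

lemma time_bigo: "(\<lambda>n. real (n * (28 * n + 51) + 8)) \<in> O(\<lambda>n. real n ^ 2)"
\<comment> \<open>The constant is 28 + 51 + 8, as each term is at most its coefficient times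
  \<open>n ^ 2\<close>.\<close>
proof (rule bigoI[where c = 87])
  show "\<forall>\<^sub>F n in sequentially. norm (real (n * (28 * n + 51) + 8)) \<le> 87 * norm (real n ^ 2)"
    using eventually_ge_at_top[of 1]
  proof eventually_elim
    case (elim n)
    then have "n * 1 \<le> n * n" "1 * 1 \<le> n * n" by (auto intro: mult_le_mono)
    moreover have "n * (28 * n + 51) + 8 = 28 * (n * n) + 51 * n + 8" by (simp add: algebra_simps)
    ultimately have "n * (28 * n + 51) + 8 \<le> 87 * n ^ 2"
      unfolding power2_eq_square by linarith
    then have "real (n * (28 * n + 51) + 8) \<le> real (87 * n ^ 2)" by (simp only: of_nat_le_iff)
    then show ?case by simp
  qed
qed

section \<open>Average case\<close>

text \<open>The concave logarithm lies below its tangent at \<open>a\<close>. An affine bound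
  commutes with the expectation and so replaces Jensen's inequality.\<close>

lemma log2_le_tangent:
  assumes "0 < a" "0 < x"
  shows "log 2 x \<le> log 2 a + (x / a - 1) / ln (2::real)"
proof -
  have "ln (x / a) \<le> x / a - 1" using assms by (intro ln_le_minus_one) simp
  then show ?thesis using assms by (simp add: log_def ln_div field_simps)
qed

text \<open>The tangent is taken at \<open>1 + g\<close>, which bounds the expected argument. Its
  slope term then has nonpositive expectation, and only the logarithm of \<open>1 + g\<close>
  remains.\<close>

lemma expectation_compressed_lcp_le:
  fixes p :: "'a::linorder list pmf"
  assumes p: "set_pmf p \<subseteq> texts d \<Sigma> n" and g: "0 \<le> g"
    and lcp: "\<And>i. i < n \<Longrightarrow> measure_pmf.expectation p (\<lambda>T. real (lcp_array T ! i)) \<le> g"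
  shows "measure_pmf.expectation p (\<lambda>T. real (length (compressed_lcp T)))
    \<le> real n * (1 + 3 * log 2 (1 + g))"
proof -
  define a where "a = 1 + g"
  have a: "0 < a" using g by (simp add: a_def)
  let ?b = "\<lambda>T i. 1 + 3 * (log 2 a + ((1 + real (lcp_array T ! i)) / a - 1) / ln 2)"
  have len: "length T = n" if "T \<in> set_pmf p" for T using p that by (auto simp: texts_def)
  \<comment> \<open>The support may be infinite when the alphabet is, but all its texts have length
    \<open>n\<close>, which bounds the entries.\<close>
  have int [intro, simp]: "integrable (measure_pmf p) (\<lambda>T. real (lcp_array T ! i))" if "i < n" for i
  proof (rule measure_pmf.integrable_const_bound[where B = "real n"])
    show "AE T in measure_pmf p. norm (real (lcp_array T ! i)) \<le> real n"
      using len that lcp_array_le by (force simp: AE_measure_pmf_iff)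
  qed simp
  have le: "real (length (compressed_lcp T)) \<le> (\<Sum>i<n. ?b T i)" if "T \<in> set_pmf p" for T
  proof -
    have "real (length (compressed_lcp T)) = (\<Sum>i<n. real (length (elias_delta (Suc (lcp_array T ! i)))))"
      using len[OF that]
      by (simp add: compressed_lcp_def length_concat sum_list_sum_nth atLeast0LessThan)
    also have "\<dots> \<le> (\<Sum>i<n. ?b T i)"
    proof (rule sum_mono)
      fix i
      let ?l = "lcp_array T ! i"
      have "real (length (elias_delta (Suc ?l))) \<le> real (3 * floor_log (Suc ?l) + 1)"
        using length_elias_delta_le by (simp only: of_nat_le_iff)
      also have "\<dots> \<le> 1 + 3 * log 2 (real (Suc ?l))"
        using floor_log_le_log[of "Suc ?l"] by simp
      also have "\<dots> \<le> ?b T i"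
        using log2_le_tangent[OF a, of "real (Suc ?l)"]
        by (intro add_left_mono mult_left_mono) simp_all
      finally show "real (length (elias_delta (Suc ?l))) \<le> ?b T i" .
    qed
    finally show ?thesis .
  qed
  have intb: "integrable (measure_pmf p) (\<lambda>T. \<Sum>i<n. ?b T i)" by auto
  have "measure_pmf.expectation p (\<lambda>T. real (length (compressed_lcp T)))
      \<le> measure_pmf.expectation p (\<lambda>T. \<Sum>i<n. ?b T i)"
  proof (rule integral_mono_AE)
    show "integrable (measure_pmf p) (\<lambda>T. real (length (compressed_lcp T)))"
      using le by (intro Bochner_Integration.integrable_bound[OF intb])
        (auto simp: AE_measure_pmf_iff intro: order_trans[OF _ abs_ge_self])
    show "AE T in measure_pmf p. real (length (compressed_lcp T)) \<le> (\<Sum>i<n. ?b T i)"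
      using le by (simp add: AE_measure_pmf_iff)
  qed (rule intb)
  also have "\<dots> = (\<Sum>i<n. measure_pmf.expectation p (\<lambda>T. ?b T i))"
    by (intro Bochner_Integration.integral_sum) auto
  also have "\<dots> \<le> (\<Sum>i<n. 1 + 3 * log 2 a)"
  proof (rule sum_mono)
    fix i assume "i \<in> {..<n}"
    then have i: "i < n" by simp
    let ?E = "measure_pmf.expectation p (\<lambda>T. real (lcp_array T ! i))"
    define X where "X = ((1 + ?E) / a - 1) / ln 2"
    have "measure_pmf.expectation p (\<lambda>T. ?b T i) = 1 + 3 * (log 2 a + X)"
      unfolding X_def using i by (simp add: measure_pmf.prob_space)
    moreover have "(1 + ?E) / a \<le> 1" using lcp[OF i] a by (simp add: a_def)
    then have "X \<le> 0" by (simp add: X_def divide_le_0_iff)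
    ultimately show "measure_pmf.expectation p (\<lambda>T. ?b T i) \<le> 1 + 3 * log 2 a"
      by (simp only: distrib_left)
  qed
  finally show ?thesis by (simp add: a_def)
qed

lemma average_compressed_lcp_bigo:
  fixes D :: "nat \<Rightarrow> 'a::linorder list pmf"
  assumes D: "\<And>n. 2 \<le> n \<Longrightarrow> set_pmf (D n) \<subseteq> texts d \<Sigma> n"
    and g: "g \<in> O(\<lambda>n. log 2 (real n))"
    and lcp: "\<And>n i. 2 \<le> n \<Longrightarrow> i < n \<Longrightarrow>
      measure_pmf.expectation (D n) (\<lambda>T. real (lcp_array T ! i)) \<le> g n"
  shows "(\<lambda>n. measure_pmf.expectation (D n) (\<lambda>T. real (length (compressed_lcp T))))
    \<in> O(\<lambda>n. real n * log 2 (log 2 (real n)))"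
proof -
  obtain C where C: "0 < C" "\<forall>\<^sub>F n in sequentially. norm (g n) \<le> C * norm (log 2 (real n))"
    using landau_o.bigE[OF g] by blast
  \<comment> \<open>From \<open>n = 4\<close> on, \<open>log 2 (log 2 n)\<close> is at least 1, so
    it may multiply the constant 1 and \<open>log 2 (1 + C)\<close>; collecting the factors gives
    \<open>K\<close>.\<close>
  define K where "K = 1 + 3 * (log 2 (1 + C) + 1)"
  show ?thesis
  proof (rule bigoI[where c = K])
    show "\<forall>\<^sub>F n in sequentially.
      norm (measure_pmf.expectation (D n) (\<lambda>T. real (length (compressed_lcp T))))
        \<le> K * norm (real n * log 2 (log 2 (real n)))"
      using C(2) eventually_ge_at_top[of 4]
    proof eventually_elim
      case (elim n)
      let ?L = "log 2 (real n)"
      have "log 2 4 \<le> ?L" using elim by simp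
      moreover have "log 2 4 = (2::real)" using log_pow_cancel[of 2 2] by simp
      ultimately have L: "2 \<le> ?L" by simp
      then have LL: "1 \<le> log 2 ?L" by simp
      \<comment> \<open>\<open>g n\<close> bounds the expectation of entry 0, which is
        nonnegative.\<close>
      have g0: "0 \<le> g n"
        using order_trans[OF Bochner_Integration.integral_nonneg lcp[of n 0]] elim by simp
      have "g n \<le> C * ?L" using elim L by simp
      then have "1 + g n \<le> (1 + C) * ?L" using L by (simp add: algebra_simps)
      then have "log 2 (1 + g n) \<le> log 2 ((1 + C) * ?L)" using g0 L C by simp
      also have "\<dots> = log 2 (1 + C) + log 2 ?L" using L C by (subst log_mult) auto
      also have "\<dots> \<le> log 2 (1 + C) * log 2 ?L + log 2 ?L"
        using LL C mult_left_mono[OF LL, of "log 2 (1 + C)"] by simp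
      finally have "1 + 3 * log 2 (1 + g n) \<le> K * log 2 ?L"
        using LL by (simp add: K_def algebra_simps)
      then have "real n * (1 + 3 * log 2 (1 + g n)) \<le> real n * (K * log 2 ?L)"
        by (rule mult_left_mono) simp
      then have "real n * (1 + 3 * log 2 (1 + g n)) \<le> K * (real n * log 2 ?L)"
        by (simp only: mult.left_commute)
      moreover have "measure_pmf.expectation (D n) (\<lambda>T. real (length (compressed_lcp T)))
        \<le> real n * (1 + 3 * log 2 (1 + g n))"
        using elim D[of n] lcp[of n] g0 by (intro expectation_compressed_lcp_le) auto
      moreover have "0 \<le> measure_pmf.expectation (D n) (\<lambda>T. real (length (compressed_lcp T)))" by simp
      ultimately show ?case using LL by simp
    qed
  qed
qed

text \<open>The program and the number of registers are chosen before the text and the word size,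
  which expresses constant additional space. The average case covers every family of distributions
  whose expected entries have a common logarithmic bound \<open>g\<close>.\<close>

theorem theorem2:
  shows
    "(\<exists>P k c f. c > 0 \<and> (\<lambda>n. real (f n)) \<in> O(\<lambda>n. real n ^ 2) \<and>
        (\<forall>(d::'a::linorder) \<Sigma> n T w s.
           (\<forall>x\<in>\<Sigma>. d < x) \<and> T \<in> texts d \<Sigma> n \<and> real w \<ge> c * log 2 (real n) \<and>
           initial w k T s \<longrightarrow>
             (\<exists>t s'. exec w P s t s' \<and> t \<le> f n \<and>
                     tarr s' = bwt d T \<and> barr s' = compressed_lcp T)))
     \<and>
     (\<forall>(d::'a) \<Sigma> (D :: nat \<Rightarrow> 'a list pmf) g.
        (\<forall>x\<in>\<Sigma>. d < x) \<and> (\<forall>n\<ge>2. set_pmf (D n) \<subseteq> texts d \<Sigma> n) \<and>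
        g \<in> O(\<lambda>n. log 2 (real n)) \<and>
        (\<forall>n\<ge>2. \<forall>i<n. measure_pmf.expectation (D n) (\<lambda>T. real (lcp_array T ! i)) \<le> g n) \<longrightarrow>
          (\<lambda>n. measure_pmf.expectation (D n) (\<lambda>T. real (length (compressed_lcp T))))
            \<in> O(\<lambda>n. real n * log 2 (log 2 (real n))))"
proof (intro conjI allI impI)
  have "\<exists>t s'. exec w bwt_lcp s t s' \<and> t \<le> n * (28 * n + 51) + 8 \<and>
      tarr s' = bwt d T \<and> barr s' = compressed_lcp T"
    if "(\<forall>x\<in>\<Sigma>. d < x) \<and> T \<in> texts d \<Sigma> n \<and> real w \<ge> 6 * log 2 (real n) \<and> initial w regs T s"
    for d :: 'a and \<Sigma> n T w s
    using that wp_bwt_lcp[of \<Sigma> d T n w s] unfolding wp_def by blast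
  then show "\<exists>P k c f. c > 0 \<and> (\<lambda>n. real (f n)) \<in> O(\<lambda>n. real n ^ 2) \<and>
        (\<forall>(d::'a::linorder) \<Sigma> n T w s.
           (\<forall>x\<in>\<Sigma>. d < x) \<and> T \<in> texts d \<Sigma> n \<and> real w \<ge> c * log 2 (real n) \<and>
           initial w k T s \<longrightarrow>
             (\<exists>t s'. exec w P s t s' \<and> t \<le> f n \<and>
                     tarr s' = bwt d T \<and> barr s' = compressed_lcp T))"
    by (intro exI[of _ bwt_lcp] exI[of _ regs] exI[of _ 6] exI[of _ "\<lambda>n. n * (28 * n + 51) + 8"]
        conjI time_bigo) auto
next
  fix d :: 'a and \<Sigma> and D :: "nat \<Rightarrow> 'a list pmf" and g
  assume "(\<forall>x\<in>\<Sigma>. d < x) \<and> (\<forall>n\<ge>2. set_pmf (D n) \<subseteq> texts d \<Sigma> n) \<and>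
    g \<in> O(\<lambda>n. log 2 (real n)) \<and>
    (\<forall>n\<ge>2. \<forall>i<n. measure_pmf.expectation (D n) (\<lambda>T. real (lcp_array T ! i)) \<le> g n)"
  then show "(\<lambda>n. measure_pmf.expectation (D n) (\<lambda>T. real (length (compressed_lcp T))))
      \<in> O(\<lambda>n. real n * log 2 (log 2 (real n)))"
    by (intro average_compressed_lcp_bigo) auto
qed

end
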